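(* Let $n\ge 2$. For $\delta\in(0,\frac{\pi}{2}]$ let $\mu(\delta)$ be the first nonzero Neumann eigenvalue of the geodesic ball $B(\delta)\subset\mathbb{S}^n$, and let $\delta_0$ be the unique zero in $(0,\frac{\pi}{2})$ of the function $$F(\delta)=\frac{n+1}{8n}\left[1-\left(1-\frac{n}{2\mu(\delta)}\right)\cos\delta\right]^{-1}+\frac{(n+3)\cos^2\delta-4}{4\sin^2\delta}.$$ Then: (i) $\delta_0>\tilde\delta_0$, where $\tilde\delta_0$ is the unique zero in $(0,\frac{\pi}{2})$ of the equation $$\left[1-\left(1-\frac{n}{2\tilde\mu(\delta)}\right)\cos\delta\right]^{-1}\frac{n+1}{8n}+\frac{(n+3)\cos^2\delta-4}{4(1-\cos^2\delta)}=0,$$ with $$\tilde\mu(\delta)=n+\frac{(\sin\delta)^{n-2}\cos\delta}{\int_0^\delta(\sin t)^{n-1}\,dt}.$$ (ii) $\cos\delta_0<\tilde\kappa$, where $\tilde\kappa$ is the unique zero in $(0,1)$ of the equation $$n(n+3)x^4+n(n+3)x^3+2n(n+1)x^2+(1-3n)x-7n+1=0.$$ (iii) $\displaystyle(\cos\delta_0)^2<\frac{7n-1}{2n^2+5n-1}.$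
   Context: $\mathbb{S}^n$ is the unit $n$-sphere with its standard metric $\bar g$. $B(\delta)$ is a closed geodesic ball of radius $\delta$. The first nonzero Neumann eigenvalue $\mu(\delta)$ of $B(\delta)$ is the smallest $\mu>0$ for which there is a nonzero $u$ with $-\Delta_{\bar g}u=\mu u$ in $B(\delta)$ and vanishing normal derivative on $\partial B(\delta)$. The function $F$ has exactly one zero in $(0,\frac{\pi}{2})$. *)

theory Defs
  imports "HOL-Analysis.Analysis"
begin

text \<open>
  The sphere \<open>\<S>\<^sup>n\<close> is \<^term>\<open>sphere 0 1\<close> in a Euclidean space of dimension \<open>n + 1\<close>, with
  the metric induced by the inner product. Functions on subsets of it are represented by functions
  on the ambient space. The operators below only differentiate in directions tangent to the
  sphere, so their values on the sphere depend only on the restriction of the function to the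
  sphere, not on the way it is extended to the ambient space.
\<close>

primrec Ck_on :: "nat \<Rightarrow> ('a::euclidean_space \<Rightarrow> real) \<Rightarrow> 'a set \<Rightarrow> bool" where
  "Ck_on 0 f U \<longleftrightarrow> continuous_on U f"
| "Ck_on (Suc k) f U \<longleftrightarrow>
     f differentiable_on U \<and> (\<forall>b\<in>Basis. Ck_on k (\<lambda>x. frechet_derivative f (at x) b) U)"

text \<open>Meaningful for open \<open>U\<close> only.\<close>

definition smooth_on :: "('a::euclidean_space \<Rightarrow> real) \<Rightarrow> 'a set \<Rightarrow> bool" where
  "smooth_on f U \<longleftrightarrow> (\<forall>k. Ck_on k f U)"

text \<open>
  For a unit vector \<open>x\<close>, the orthogonal projection onto the tangent space of the sphere at \<open>x\<close>.
\<close>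

definition tangent_proj :: "'a::euclidean_space \<Rightarrow> 'a \<Rightarrow> 'a" where
  "tangent_proj x v = v - (v \<bullet> x) *\<^sub>R x"

text \<open>The Riemannian gradient is the tangential part of the ambient gradient.\<close>

definition sphere_grad :: "('a::euclidean_space \<Rightarrow> real) \<Rightarrow> 'a \<Rightarrow> 'a" where
  "sphere_grad u x = (\<Sum>b\<in>Basis. frechet_derivative u (at x) b *\<^sub>R tangent_proj x b)"

text \<open>
  The Levi-Civita connection of the sphere is the tangential part of the ambient derivative. So the
  divergence of a tangent field \<open>X\<close> is the trace of \<open>P \<circ> DX \<circ> P\<close>, where \<open>P\<close> is
  \<^term>\<open>tangent_proj x\<close>; since \<open>P\<close> is self-adjoint, this trace is the sum below.
\<close>

definition sphere_div :: "('a::euclidean_space \<Rightarrow> 'a) \<Rightarrow> 'a \<Rightarrow> real" where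
  "sphere_div X x =
     (\<Sum>b\<in>Basis. frechet_derivative X (at x) (tangent_proj x b) \<bullet> tangent_proj x b)"

definition sphere_laplacian :: "('a::euclidean_space \<Rightarrow> real) \<Rightarrow> 'a \<Rightarrow> real" where
  "sphere_laplacian u x = sphere_div (sphere_grad u) x"

text \<open>The geodesic distance of unit vectors \<open>p\<close> and \<open>x\<close> is the angle \<^term>\<open>arccos (p \<bullet> x)\<close>.\<close>

definition geodesic_ball :: "'a::euclidean_space \<Rightarrow> real \<Rightarrow> 'a set" where
  "geodesic_ball p \<delta> = {x \<in> sphere 0 1. arccos (p \<bullet> x) \<le> \<delta>}"

definition geodesic_sphere :: "'a::euclidean_space \<Rightarrow> real \<Rightarrow> 'a set" where
  "geodesic_sphere p \<delta> = {x \<in> sphere 0 1. arccos (p \<bullet> x) = \<delta>}"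

text \<open>
  At \<open>x\<close> at distance \<open>\<delta>\<close> from \<open>p\<close>, the velocity at \<open>x\<close> of the unit-speed geodesic running
  from \<open>p\<close> through \<open>x\<close>.
\<close>

definition outward_normal :: "'a::euclidean_space \<Rightarrow> real \<Rightarrow> 'a \<Rightarrow> 'a" where
  "outward_normal p \<delta> x = (1 / sin \<delta>) *\<^sub>R (cos \<delta> *\<^sub>R x - p)"

text \<open>
  Eigenfunctions are smooth up to the boundary: they extend smoothly to an ambient neighbourhood of
  the closed ball.
\<close>

definition neumann_eigenvalue :: "'a::euclidean_space \<Rightarrow> real \<Rightarrow> real \<Rightarrow> bool" where
  "neumann_eigenvalue p \<delta> m \<longleftrightarrow>
     (\<exists>u U. open U \<and> geodesic_ball p \<delta> \<subseteq> U \<and> smooth_on u U \<and>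
        (\<exists>x\<in>geodesic_ball p \<delta>. u x \<noteq> 0) \<and>
        (\<forall>x\<in>geodesic_ball p \<delta>. - sphere_laplacian u x = m * u x) \<and>
        (\<forall>x\<in>geodesic_sphere p \<delta>. sphere_grad u x \<bullet> outward_normal p \<delta> x = 0))"

definition is_first_neumann_eigenvalue :: "'a::euclidean_space \<Rightarrow> real \<Rightarrow> real \<Rightarrow> bool" where
  "is_first_neumann_eigenvalue p \<delta> m \<longleftrightarrow>
     0 < m \<and> neumann_eigenvalue p \<delta> m \<and> (\<forall>m'>0. neumann_eigenvalue p \<delta> m' \<longrightarrow> m \<le> m')"

definition F :: "nat \<Rightarrow> (real \<Rightarrow> real) \<Rightarrow> real \<Rightarrow> real" where
  "F n \<mu> \<delta> =
     (real n + 1) / (8 * real n) * inverse (1 - (1 - real n / (2 * \<mu> \<delta>)) * cos \<delta>) +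
     ((real n + 3) * (cos \<delta>)\<^sup>2 - 4) / (4 * (sin \<delta>)\<^sup>2)"

definition mu_tilde :: "nat \<Rightarrow> real \<Rightarrow> real" where
  "mu_tilde n \<delta> =
     real n + sin \<delta> ^ (n - 2) * cos \<delta> / integral {0..\<delta>} (\<lambda>t. sin t ^ (n - 1))"

definition F_tilde :: "nat \<Rightarrow> real \<Rightarrow> real" where
  "F_tilde n \<delta> =
     inverse (1 - (1 - real n / (2 * mu_tilde n \<delta>)) * cos \<delta>) * ((real n + 1) / (8 * real n)) +
     ((real n + 3) * (cos \<delta>)\<^sup>2 - 4) / (4 * (1 - (cos \<delta>)\<^sup>2))"

end

theory Submission
  imports Defs
begin

text \<open>
  Everything rests on the strict bound \<open>m > mu_tilde n \<delta>\<close> for every positive Neumann eigenvalue \<open>m\<close> of a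
  ball of radius \<open>\<delta> < pi / 2\<close>. Let \<open>u\<close> be an eigenfunction with \<open>m \<le> mu_tilde n \<delta>\<close>. If \<open>e\<close> is a unit
  vector orthogonal to the centre \<open>p\<close> and \<open>v\<close> is the part of \<open>u\<close> that is odd under the reflection in the
  hyperplane orthogonal to \<open>e\<close>, then \<open>v\<close> is compared on the half ball \<open>e \<bullet> x \<ge> 0\<close> with an explicit positive strict
  supersolution \<open>(e \<bullet> x) H(r)\<close>, and the maximum principle gives \<open>v = 0\<close>. Hence \<open>u\<close> is a radial function
  \<open>f(r)\<close>; its derivative \<open>f'\<close> solves the same equation as the radial factor of an odd eigenfunction, but with
  Dirichlet conditions at both ends, and the same supersolution forces \<open>f' = 0\<close>.

  Since \<open>F\<close> increases with the eigenvalue, \<open>F_tilde n\<close> is negative at \<open>\<delta>\<^sub>0\<close>, and \<open>F_tilde n\<close> is strictly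
  decreasing. The quartic comes from replacing \<open>mu_tilde n \<delta>\<close> by its lower bound \<open>n / (sin \<delta>)\<^sup>2\<close>.
\<close>

section \<open>A supersolution of the Riccati equation\<close>

text \<open>The supersolution dictates the number \<open>mu_tilde n \<delta>\<close>. If H' = - y H
  and e \<bullet> x > 0, then (e \<bullet> x) H(r) is a supersolution for m exactly when y' + (n +
  1) y cot r - y^2 + n >= m, and its Neumann condition is y(\<delta>) = cot \<delta>. Keeping only
  the linear equation y' + (n - 1) y cot r = L gives an explicit y, and the boundary condition then
  fixes L as \<open>mu_tilde n \<delta> - n\<close>. The remainder y (2 cot r - y) is positive,
  whence the strict inequality. Two arguments are needed because a radial function is invariant
  under every reflection that fixes p, so comparing odd parts cannot detect it. Both are pointwise:
  one uses the conditions at a maximum, the other the monotonicity of a single function of r. With k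
  = n - 2, the exponents n - 1 and n - 2 become k + 1 and k, which avoids truncated
  subtraction.\<close>

definition sin_int :: "nat \<Rightarrow> real \<Rightarrow> real" where
  "sin_int k r = integral {0..r} (\<lambda>t. sin t ^ (k + 1))"

lemma sin_int_0 [simp]: "sin_int k 0 = 0"
  by (simp add: sin_int_def)

lemma sin_int_has_derivative:
  assumes "0 < r"
  shows "(sin_int k has_real_derivative sin r ^ (k + 1)) (at r)"
proof -
  have "((\<lambda>x. integral {0..x} (\<lambda>t. sin t ^ (k + 1))) has_real_derivative sin r ^ (k + 1))
          (at r within {0..r + 1})"
    using assms by (intro integral_has_real_derivative continuous_intros) auto
  moreover have "at r within {0..r + 1} = at r"
    using assms by (intro at_within_interior) (auto simp: interior_atLeastAtMost_real)
  ultimately show ?thesis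
    by (simp add: sin_int_def[abs_def])
qed

lemma continuous_on_sin_int: "continuous_on {0..b} (sin_int k)"
  unfolding sin_int_def[abs_def]
  by (intro indefinite_integral_continuous_1 integrable_continuous_interval continuous_intros)

lemma sin_power_has_derivative:
  "((\<lambda>r. sin r ^ (k + 1)) has_real_derivative (real k + 1) * sin x ^ k * cos x) (at x)"
  by (rule DERIV_cong[OF DERIV_power[OF DERIV_sin]]) simp

text \<open>Dropping the factor cos from the derivative of \<open>sin r ^ (k + 2)\<close> can only
  enlarge it.\<close>

lemma sin_int_lower:
  assumes "0 \<le> r" "r \<le> pi / 2"
  shows "sin r ^ (k + 2) \<le> (real k + 2) * sin_int k r"
proof -
  have "(\<lambda>r. (real k + 2) * sin_int k r - sin r ^ (k + 2)) 0
          \<le> (\<lambda>r. (real k + 2) * sin_int k r - sin r ^ (k + 2)) r"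
  proof (rule DERIV_nonneg_imp_increasing_open[OF assms(1)])
    fix x assume x: "0 < x" "x < r"
    have "((\<lambda>r. (real k + 2) * sin_int k r - sin r ^ (k + 2)) has_real_derivative
           (real k + 2) * sin x ^ (k + 1) * (1 - cos x)) (at x)"
      using sin_power_has_derivative[of "k + 1" x] sin_int_has_derivative[OF x(1), of k]
      by (auto intro!: derivative_eq_intros simp: algebra_simps simp flip: power_Suc)
    moreover have "0 \<le> sin x" using x assms by (intro sin_ge_zero) auto
    then have "0 \<le> (real k + 2) * sin x ^ (k + 1) * (1 - cos x)" by simp
    ultimately show "\<exists>y. ((\<lambda>r. (real k + 2) * sin_int k r - sin r ^ (k + 2)) has_real_derivative y) (at x)
       \<and> 0 \<le> y"
      by blast
  qed (intro continuous_intros continuous_on_sin_int)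
  then show ?thesis by simp
qed

lemma sin_int_pos:
  assumes "0 < r" "r \<le> pi / 2"
  shows "0 < sin_int k r"
proof -
  have "0 < sin r" using assms by (intro sin_gt_zero) auto
  then have "0 < sin r ^ (k + 2)" by simp
  also have "\<dots> \<le> (real k + 2) * sin_int k r" using assms by (intro sin_int_lower) auto
  finally show ?thesis by (simp add: zero_less_mult_iff)
qed

text \<open>In the derivative of the difference the terms with
  \<open>cos r * sin r ^ (k + 1)\<close> cancel, and \<open>(k + 2) * sin r * sin_int k r\<close>
  remains. The estimate also yields the bound n / sin^2 \<delta> for
  \<open>mu_tilde\<close>.\<close>

lemma sin_int_upper:
  assumes "0 \<le> r" "r \<le> pi / 2"
  shows "(real k + 2) * (cos r * sin_int k r) \<le> sin r ^ (k + 2)"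
proof -
  let ?f = "\<lambda>r. sin r ^ (k + 2) - (real k + 2) * (cos r * sin_int k r)"
  have "?f 0 \<le> ?f r"
  proof (rule DERIV_nonneg_imp_increasing_open[OF assms(1)])
    fix x assume x: "0 < x" "x < r"
    have D: "(?f has_real_derivative (real k + 2) * (sin x * sin_int k x)) (at x)"
      using sin_power_has_derivative[of "k + 1" x] sin_int_has_derivative[OF x(1), of k]
      by (auto intro!: derivative_eq_intros simp: algebra_simps simp flip: power_Suc)
    have "0 \<le> sin x" using x assms by (intro sin_ge_zero) auto
    moreover have "0 < sin_int k x" using x assms by (intro sin_int_pos) auto
    ultimately have "0 \<le> (real k + 2) * (sin x * sin_int k x)" by simp
    with D show "\<exists>y. (?f has_real_derivative y) (at x) \<and> 0 \<le> y"
      by blast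
  qed (intro continuous_intros continuous_on_sin_int)
  then show ?thesis by simp
qed

text \<open>
  With \<open>n = k + 2\<close>, the barrier \<open>y\<close> satisfies \<open>y' + (n + 1) cot r y - y\<^sup>2 = L + y (2 cot r - y)\<close>. As long as
  \<open>0 < y \<le> cot r\<close>, the solution \<open>H\<close> of \<open>H' = - y H\<close> therefore makes \<open>(e \<bullet> x) H(r)\<close> a strict
  supersolution for the eigenvalue \<open>n + L\<close>.
\<close>

definition barrier :: "nat \<Rightarrow> real \<Rightarrow> real \<Rightarrow> real" where
  "barrier k L r = L * sin_int k r / sin r ^ (k + 1)"

lemma barrier_has_derivative:
  assumes "0 < r" "r < pi / 2"
  shows "(barrier k L has_real_derivative L - (real k + 1) * (cos r / sin r) * barrier k L r) (at r)"
proof -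
  have s: "0 < sin r" using assms by (intro sin_gt_zero) auto
  show ?thesis
    unfolding barrier_def[abs_def] using s assms
    by (auto intro!: derivative_eq_intros sin_int_has_derivative sin_power_has_derivative
             simp: divide_simps power2_eq_square simp del: power_Suc)
       (simp add: algebra_simps)
qed

text \<open>By monotonicity, the barrier stays below the cotangent if it does so at the right end point.\<close>

lemma cot_ratio_strict_mono:
  assumes "0 < a" "a < b" "b < pi / 2"
  shows "barrier k 1 a * (sin a / cos a) < barrier k 1 b * (sin b / cos b)"
proof (rule DERIV_pos_imp_increasing_open[OF assms(2)])
  let ?f = "\<lambda>r. barrier k 1 r * (sin r / cos r)"
  have D: "(?f has_real_derivative
       (1 - (real k + 1) * (cos x / sin x) * barrier k 1 x) * (sin x / cos x)
         + barrier k 1 x * (1 / (cos x)\<^sup>2)) (at x)" if "0 < x" "x < pi / 2" for x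
  proof -
    have c: "0 < cos x" using that by (intro cos_gt_zero_pi) auto
    have "((\<lambda>r. sin r / cos r) has_real_derivative 1 / (cos x)\<^sup>2) (at x)"
      using c by (auto intro!: derivative_eq_intros)
                 (simp add: sin_squared_eq power2_eq_square divide_simps flip: power2_eq_square)
    from DERIV_mult[OF barrier_has_derivative[OF that, of k 1] this] show ?thesis
      by (rule DERIV_cong) simp
  qed
  {
    fix x assume "a < x" "x < b"
    then have x: "0 < x" "x < pi / 2" using assms by auto
    have c: "0 < cos x" using x by (intro cos_gt_zero_pi) auto
    have s: "0 < sin x" using x by (intro sin_gt_zero) auto
    define P where "P = barrier k 1 x"
    have P: "0 < P" using s sin_int_pos[of x k] x by (simp add: P_def barrier_def)
    have "(real k + 2) * (cos x * P) \<le> sin x"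
      using sin_int_upper[of x k] x s by (simp add: P_def barrier_def divide_simps mult_ac)
    \<comment> \<open>\<open>sin_int_upper\<close> carries the factor k + 2, the derivative of the
      barrier only k + 1; this gap makes the first summand positive.\<close>
    moreover have "(real k + 1) * (cos x * P) < (real k + 2) * (cos x * P)"
      using c P by (intro mult_strict_right_mono) auto
    ultimately have "(real k + 1) * (cos x * P) < sin x" by simp
    then have "(1 - (real k + 1) * (cos x / sin x) * P) > 0"
      using s by (simp add: field_simps)
    then have "0 < (1 - (real k + 1) * (cos x / sin x) * P) * (sin x / cos x) + P * (1 / (cos x)\<^sup>2)"
      using c s P by (intro add_pos_pos mult_pos_pos) auto
    with D[OF x] show "\<exists>y. (?f has_real_derivative y) (at x) \<and> 0 < y"
      unfolding P_def by blast
  }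
  show "continuous_on {a..b} ?f"
    using assms by (intro DERIV_continuous_on[OF has_field_derivative_at_within[OF D]]) auto
qed

lemma barrier_scale: "barrier k L r = L * barrier k 1 r"
  by (simp add: barrier_def)

text \<open>Near the pole the barrier tends to 0 while cot blows up, but by
  \<open>sin_int_lower\<close> the product stays away from 0. This is the slack that
  \<open>barrier_bounds\<close> distributes.\<close>

lemma barrier_cot_lower:
  assumes "0 < r" "r < pi / 2" "0 < L"
  shows "L * cos r / (real k + 2) \<le> barrier k L r * (cos r / sin r)"
proof -
  have c: "0 < cos r" using assms by (intro cos_gt_zero_pi) auto
  have s: "0 < sin r" using assms by (intro sin_gt_zero) auto
  have "L * cos r * sin r ^ (k + 2) \<le> L * cos r * ((real k + 2) * sin_int k r)"
    using c assms by (intro mult_left_mono sin_int_lower) auto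
  then show ?thesis
    using s by (simp add: barrier_def divide_simps mult_ac)
qed

lemma barrier_bounds:
  assumes d: "0 < d" "d < pi / 2" and l: "l = sin d ^ k * cos d / sin_int k d"
  obtains L \<kappa> where "0 < \<kappa>" "0 < L" "barrier k L d < cos d / sin d"
    "\<And>r. 0 < r \<Longrightarrow> r \<le> d \<Longrightarrow>
       l + \<kappa> \<le> L + barrier k L r * (2 * (cos r / sin r) - barrier k L r)"
proof -
  \<comment> \<open>\<open>L\<close> is slightly smaller than \<open>l\<close>, so that \<open>cot - y\<close> stays positive at the boundary; the strict
    excess \<open>y cot r\<close> of the supersolution pays for it.\<close>
  define L where "L = l / (1 + cos d / (2 * (real k + 2)))"
  have cd: "0 < cos d" using d by (intro cos_gt_zero_pi) auto
  have sd: "0 < sin d" using d by (intro sin_gt_zero) auto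
  have l0: "0 < l" using cd sd sin_int_pos[of d k] d by (simp add: l)
  have L0: "0 < L" using l0 cd by (simp add: L_def add_pos_pos)
  have lL: "l = L * (1 + cos d / (2 * (real k + 2)))"
  proof -
    have "0 < 1 + cos d / (2 * (real k + 2))" using cd by (intro add_pos_pos divide_pos_pos) auto
    then show ?thesis by (simp add: L_def)
  qed
  have Ll: "L < l" using lL L0 cd by (simp add: distrib_left)
  \<comment> \<open>The slack \<open>L * cos d / (k + 2)\<close> is halved: one half equals
    \<open>l - L\<close>, the other is left over as \<kappa>.\<close>
  let ?\<kappa> = "L * cos d / (2 * (real k + 2))"
  have k0: "0 < ?\<kappa>" using L0 cd by simp
  \<comment> \<open>For L = l the barrier would meet cot at d, which is the Neumann
    condition.\<close>
  have bd: "l * barrier k 1 d = cos d / sin d"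
    using sd cd sin_int_pos[of d k] d by (simp add: l barrier_def)
  have B1: "0 < barrier k 1 r" if "0 < r" "r \<le> d" for r
  proof -
    have "0 < sin r" using that d by (intro sin_gt_zero) auto
    then show ?thesis using sin_int_pos[of r k] that d by (simp add: barrier_def)
  qed
  have bL: "barrier k L d < cos d / sin d"
    unfolding bd[symmetric] barrier_scale[of k L] using Ll B1[of d] d by simp
  have "l + ?\<kappa> \<le> L + barrier k L r * (2 * (cos r / sin r) - barrier k L r)"
    if r: "0 < r" "r \<le> d" for r
  proof -
  have r2: "r < pi / 2" using d r by simp
  have c: "0 < cos r" using r r2 by (intro cos_gt_zero_pi) auto
  have s: "0 < sin r" using r r2 by (intro sin_gt_zero) auto
  have "barrier k 1 r * (sin r / cos r) \<le> barrier k 1 d * (sin d / cos d)"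
    using cot_ratio_strict_mono[of r d k] r d by (cases "r = d") auto
  then have "l * (barrier k 1 r * (sin r / cos r)) \<le> l * (barrier k 1 d * (sin d / cos d))"
    using l0 by (intro mult_left_mono) auto
  also have "\<dots> = (l * barrier k 1 d) * (sin d / cos d)" by simp
  also have "\<dots> = 1" unfolding bd using sd cd by simp
  finally have "l * barrier k 1 r \<le> cos r / sin r"
    using c s by (simp add: field_simps)
  moreover have "barrier k L r \<le> l * barrier k 1 r"
    unfolding barrier_scale[of k L] using Ll B1[OF r] by simp
  ultimately have 1: "barrier k L r \<le> cos r / sin r" by simp
  have 2: "0 < barrier k L r"
    unfolding barrier_scale[of k L] using L0 B1[OF r] by simp
  have "L * cos d / (real k + 2) \<le> L * cos r / (real k + 2)"
    using L0 r d by (intro divide_right_mono mult_left_mono cos_monotone_0_pi_le) auto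
  also have "\<dots> \<le> barrier k L r * (cos r / sin r)"
    using r r2 L0 by (intro barrier_cot_lower)
  also have "\<dots> \<le> barrier k L r * (2 * (cos r / sin r) - barrier k L r)"
    using 1 2 by (intro mult_left_mono) auto
  finally have "L * cos d / (real k + 2) \<le> \<dots>" .
  moreover have "l + ?\<kappa> = L + L * cos d / (real k + 2)"
  proof -
    have "L * (1 + a / (2 * c)) + L * a / (2 * c) = L + L * a / c" if "0 < c" for a c :: real
      using that by (simp add: field_simps)
    from this[of "real k + 2" "cos d"] show ?thesis unfolding lL[symmetric] by simp
  qed
  ultimately show "l + ?\<kappa> \<le> L + barrier k L r * (2 * (cos r / sin r) - barrier k L r)"
    by simp
  qed
  with k0 L0 bL show ?thesis by (rule that)
qed

section \<open>Regularity of the barrier at the pole, and its integrating factor\<close>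

lemma continuous_on_barrier:
  assumes "b < pi / 2"
  shows "continuous_on {0..b} (barrier k L)"
  unfolding continuous_on_eq_continuous_within
proof
  fix x assume x: "x \<in> {0..b}"
  show "continuous (at x within {0..b}) (barrier k L)"
  proof (cases "x = 0")
    case False
    then have "isCont (barrier k L) x" using x assms
      by (intro DERIV_isCont[OF barrier_has_derivative]) auto
    then show ?thesis by (rule continuous_at_imp_continuous_within)
  next
    case True
    have lim: "((\<lambda>x. \<bar>L\<bar> * (sin x / cos x)) \<longlongrightarrow> 0) (at 0 within {0..b})"
      by (auto intro!: tendsto_eq_intros)
    have "norm (barrier k L r) \<le> \<bar>L\<bar> * (sin r / cos r)" if r: "r \<in> {0..b}" "r \<noteq> 0" for r
    proof -
      have c: "0 < cos r" using r assms by (intro cos_gt_zero_pi) auto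
      have s: "0 < sin r" using r assms by (intro sin_gt_zero) auto
      have I: "0 < sin_int k r" using r assms by (intro sin_int_pos) auto
      have "1 * (cos r * sin_int k r) \<le> (real k + 2) * (cos r * sin_int k r)"
        using c I by (intro mult_right_mono) auto
      also have "\<dots> \<le> sin r ^ (k + 2)" using r assms by (intro sin_int_upper) auto
      finally have "cos r * sin_int k r \<le> sin r * sin r ^ (k + 1)" by simp
      then have "sin_int k r / sin r ^ (k + 1) \<le> sin r / cos r"
        using c s by (simp add: divide_simps mult.commute del: power_Suc)
      then have "\<bar>L\<bar> * (sin_int k r / sin r ^ (k + 1)) \<le> \<bar>L\<bar> * (sin r / cos r)"
        by (rule mult_left_mono) simp
      then show ?thesis using I s by (simp add: barrier_def abs_mult)
    qed
    then have "\<forall>\<^sub>F r in at 0 within {0..b}. norm (barrier k L r) \<le> \<bar>L\<bar> * (sin r / cos r)"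
      unfolding eventually_at_filter by (intro always_eventually) blast
    from this lim have "(barrier k L \<longlongrightarrow> 0) (at 0 within {0..b})"
      by (rule Lim_null_comparison)
    \<comment> \<open>The quotient at the pole is 0 / 0; the default value 0 of division agrees with
      the limit.\<close>
    moreover have "barrier k L 0 = 0" by (simp add: barrier_def)
    ultimately show ?thesis using True by (simp only: continuous_within)
  qed
qed

lemma barrier_exponential:
  assumes d: "0 < d" "d < pi / 2"
  obtains H h where "continuous_on {0..d} H" "0 < h" "\<And>r. r \<in> {0..d} \<Longrightarrow> h \<le> H r"
    "\<And>r. 0 < r \<Longrightarrow> r \<le> d \<Longrightarrow> (H has_real_derivative - barrier k L r * H r) (at r)"
proof -
  \<comment> \<open>Integrating up to some b > d makes d an interior point, so the derivative there
    is two-sided.\<close>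
  define b where "b = (d + pi / 2) / 2"
  have b: "d < b" "b < pi / 2" using d by (auto simp: b_def)
  define H where "H = (\<lambda>r. exp (- integral {0..r} (barrier k L)))"
  have cont: "continuous_on {0..d} H"
  proof -
    have "(barrier k L) integrable_on {0..d}"
      using continuous_on_barrier[OF d(2)] by (rule integrable_continuous_interval)
    from indefinite_integral_continuous_1[OF this] show ?thesis
      unfolding H_def by (intro continuous_on_exp continuous_on_minus)
  qed
  have "\<exists>t\<in>{0..d}. \<forall>r\<in>{0..d}. H t \<le> H r"
    using cont d by (intro continuous_attains_inf) auto
  then obtain t where t: "t \<in> {0..d}" "\<And>r. r \<in> {0..d} \<Longrightarrow> H t \<le> H r" by blast
  have D: "(H has_real_derivative - barrier k L r * H r) (at r)" if r: "0 < r" "r \<le> d" for r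
  proof -
    have "((\<lambda>r. integral {0..r} (barrier k L)) has_real_derivative barrier k L r) (at r within {0..b})"
      using r b by (intro integral_has_real_derivative continuous_on_barrier) auto
    moreover have "at r within {0..b} = at r"
      using r b by (intro at_within_interior) (auto simp: interior_atLeastAtMost_real)
    ultimately have "((\<lambda>r. integral {0..r} (barrier k L)) has_real_derivative barrier k L r) (at r)"
      by simp
    from DERIV_chain2[OF DERIV_exp DERIV_minus[OF this]] show ?thesis
      unfolding H_def by (rule DERIV_cong) (simp only: mult.commute)
  qed
  have "0 < H t" by (simp add: H_def)
  from cont this t(2) D show ?thesis by (rule that)
qed

section \<open>Second derivatives along curves\<close>

text \<open>The numbers \<open>a\<close> and \<open>b\<close> are the first and second derivative of
  \<open>f\<close> at \<open>t\<close>. Since the derivative function is hidden, product and chain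
  rules can be chained at one point without writing out derivatives on neighbourhoods.\<close>

definition jet2 :: "(real \<Rightarrow> real) \<Rightarrow> real \<Rightarrow> real \<Rightarrow> real \<Rightarrow> bool" where
  "jet2 f t a b \<longleftrightarrow> (\<exists>f'. f' t = a \<and> (\<forall>\<^sub>F s in nhds t. (f has_real_derivative f' s) (at s)) \<and>
     (f' has_real_derivative b) (at t))"

lemma jet2I:
  assumes "\<And>s. s \<in> S \<Longrightarrow> (f has_real_derivative f' s) (at s)" "open S" "t \<in> S"
    "(f' has_real_derivative b) (at t)" "f' t = a"
  shows "jet2 f t a b"
  unfolding jet2_def eventually_nhds using assms by blast

lemma jet2_DERIV: "jet2 f t a b \<Longrightarrow> (f has_real_derivative a) (at t)"
  unfolding jet2_def by (auto dest: eventually_nhds_x_imp_x)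

lemma jet2_cong:
  assumes "jet2 f t a b" "\<forall>\<^sub>F s in nhds t. f s = g s"
  shows "jet2 g t a b"
proof -
  obtain f' where f': "f' t = a" "\<forall>\<^sub>F s in nhds t. (f has_real_derivative f' s) (at s)"
     "(f' has_real_derivative b) (at t)"
    using assms(1) by (auto simp: jet2_def)
  have "\<forall>\<^sub>F s in nhds t. \<forall>\<^sub>F r in nhds s. f r = g r"
    using assms(2) by (simp add: eventually_eventually)
  with f'(2) have "\<forall>\<^sub>F s in nhds t. (g has_real_derivative f' s) (at s)"
    by eventually_elim (rule iffD1[OF DERIV_cong_ev[OF refl _ refl]])
  with f' show ?thesis by (auto simp: jet2_def)
qed

text \<open>Lets two computations of the same second derivative be equated, as
  \<open>radial_ode\<close> does.\<close>

lemma jet2_unique: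
  assumes "jet2 f t a b" "jet2 f t a' b'"
  shows "a = a'" "b = b'"
proof -
  obtain f' where f': "f' t = a" "\<forall>\<^sub>F s in nhds t. (f has_real_derivative f' s) (at s)"
     "(f' has_real_derivative b) (at t)"
    using assms(1) by (auto simp: jet2_def)
  obtain g' where g': "g' t = a'" "\<forall>\<^sub>F s in nhds t. (f has_real_derivative g' s) (at s)"
     "(g' has_real_derivative b') (at t)"
    using assms(2) by (auto simp: jet2_def)
  have ev: "\<forall>\<^sub>F s in nhds t. f' s = g' s"
    using f'(2) g'(2) by eventually_elim (rule DERIV_unique)
  from eventually_nhds_x_imp_x[OF ev] show "a = a'" using f' g' by simp
  have "(g' has_real_derivative b) (at t)"
    using ev f'(3) by (rule iffD1[OF DERIV_cong_ev[OF refl _ refl]])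
  with g'(3) show "b = b'" by (rule DERIV_unique[rotated])
qed

lemma jet2_const: "jet2 (\<lambda>_. c) t 0 0"
  by (rule jet2I[where S=UNIV]) auto

lemma jet2_add:
  assumes "jet2 f t a b" "jet2 g t a' b'"
  shows "jet2 (\<lambda>s. f s + g s) t (a + a') (b + b')"
proof -
  obtain f' where f': "f' t = a" "\<forall>\<^sub>F s in nhds t. (f has_real_derivative f' s) (at s)"
     "(f' has_real_derivative b) (at t)"
    using assms(1) by (auto simp: jet2_def)
  obtain g' where g': "g' t = a'" "\<forall>\<^sub>F s in nhds t. (g has_real_derivative g' s) (at s)"
     "(g' has_real_derivative b') (at t)"
    using assms(2) by (auto simp: jet2_def)
  have "\<forall>\<^sub>F s in nhds t. ((\<lambda>s. f s + g s) has_real_derivative f' s + g' s) (at s)"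
    using f'(2) g'(2) by eventually_elim (auto intro: derivative_eq_intros)
  moreover have "((\<lambda>s. f' s + g' s) has_real_derivative b + b') (at t)"
    using f' g' by (auto intro!: derivative_eq_intros)
  ultimately show ?thesis unfolding jet2_def using f' g' by (intro exI[of _ "\<lambda>s. f' s + g' s"]) auto
qed

lemma jet2_mult:
  assumes "jet2 f t a b" "jet2 g t a' b'"
  shows "jet2 (\<lambda>s. f s * g s) t (a * g t + f t * a') (b * g t + 2 * a * a' + f t * b')"
proof -
  obtain f' where f': "f' t = a" "\<forall>\<^sub>F s in nhds t. (f has_real_derivative f' s) (at s)"
     "(f' has_real_derivative b) (at t)"
    using assms(1) by (auto simp: jet2_def)
  obtain g' where g': "g' t = a'" "\<forall>\<^sub>F s in nhds t. (g has_real_derivative g' s) (at s)"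
     "(g' has_real_derivative b') (at t)"
    using assms(2) by (auto simp: jet2_def)
  have "\<forall>\<^sub>F s in nhds t. ((\<lambda>s. f s * g s) has_real_derivative f' s * g s + f s * g' s) (at s)"
    using f'(2) g'(2) by eventually_elim (auto intro!: derivative_eq_intros)
  moreover have "((\<lambda>s. f' s * g s + f s * g' s) has_real_derivative b * g t + 2 * a * a' + f t * b') (at t)"
    using f' g' jet2_DERIV[OF assms(1)] jet2_DERIV[OF assms(2)]
    by (auto intro!: derivative_eq_intros)
  ultimately show ?thesis unfolding jet2_def using f' g'
    by (intro exI[of _ "\<lambda>s. f' s * g s + f s * g' s"]) auto
qed

lemma jet2_cmult: "jet2 f t a b \<Longrightarrow> jet2 (\<lambda>s. c * f s) t (c * a) (c * b)"
  using jet2_mult[OF jet2_const, of f t a b c] by simp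

lemma jet2_diff:
  assumes "jet2 f t a b" "jet2 g t a' b'"
  shows "jet2 (\<lambda>s. f s - g s) t (a - a') (b - b')"
  using jet2_add[OF assms(1) jet2_cmult[OF assms(2), of "-1"]] by simp

lemma jet2_compose:
  assumes "jet2 g (f t) a' b'" "jet2 f t a b"
  shows "jet2 (\<lambda>s. g (f s)) t (a' * a) (b' * a\<^sup>2 + a' * b)"
proof -
  obtain f' where f': "f' t = a" "\<forall>\<^sub>F s in nhds t. (f has_real_derivative f' s) (at s)"
     "(f' has_real_derivative b) (at t)"
    using assms(2) by (auto simp: jet2_def)
  obtain g' where g': "g' (f t) = a'" "\<forall>\<^sub>F s in nhds (f t). (g has_real_derivative g' s) (at s)"
     "(g' has_real_derivative b') (at (f t))"
    using assms(1) by (auto simp: jet2_def)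
  have "filterlim f (nhds (f t)) (nhds t)"
    using DERIV_isCont[OF jet2_DERIV[OF assms(2)]] by (simp add: isCont_def tendsto_at_iff_tendsto_nhds)
  then have "\<forall>\<^sub>F s in nhds t. (g has_real_derivative g' (f s)) (at (f s))"
    using g'(2) by (rule eventually_compose_filterlim[rotated])
  with f'(2) have "\<forall>\<^sub>F s in nhds t. ((\<lambda>s. g (f s)) has_real_derivative g' (f s) * f' s) (at s)"
    by eventually_elim (rule DERIV_chain2)
  moreover have "((\<lambda>s. g' (f s) * f' s) has_real_derivative b' * a\<^sup>2 + a' * b) (at t)"
    using DERIV_mult[OF DERIV_chain2[OF g'(3) jet2_DERIV[OF assms(2)]] f'(3)] f' g'
    by (simp add: power2_eq_square algebra_simps)
  ultimately show ?thesis unfolding jet2_def using f' g'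
    by (intro exI[of _ "\<lambda>s. g' (f s) * f' s"]) auto
qed

text \<open>At a minimum f' vanishes. If its derivative were negative, f' would be negative just to
  the right, and by the mean value theorem f would drop below its minimum.\<close>

lemma jet2_min_nonneg:
  assumes "jet2 f t a b" "\<forall>\<^sub>F s in nhds t. f t \<le> f s"
  shows "0 \<le> b"
proof (rule ccontr)
  assume "\<not> 0 \<le> b"
  obtain f' where f': "f' t = a" "\<forall>\<^sub>F s in nhds t. (f has_real_derivative f' s) (at s)"
     "(f' has_real_derivative b) (at t)"
    using assms(1) by (auto simp: jet2_def)
  from eventually_conj[OF assms(2) f'(2)] obtain e where e: "0 < e"
    "\<And>s. dist s t < e \<Longrightarrow> f t \<le> f s \<and> (f has_real_derivative f' s) (at s)"
    by (auto simp: eventually_nhds_metric)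
  have "a = 0"
    using DERIV_local_min[OF jet2_DERIV[OF assms(1)] e(1)] e(2) by (auto simp: dist_real_def abs_minus_commute)
  obtain e' where e': "0 < e'" "\<And>h. 0 < h \<Longrightarrow> h < e' \<Longrightarrow> f' (t + h) < f' t"
    using DERIV_neg_dec_right[OF f'(3)] \<open>\<not> 0 \<le> b\<close> by auto
  define s where "s = t + min e e' / 2"
  have s: "t < s" "s - t < e" "s - t < e'" using e(1) e'(1) by (auto simp: s_def min_def)
  have "\<exists>z. t < z \<and> z < s \<and> f s - f t = (s - t) * f' z"
    using s e(2) by (intro MVT2) (auto simp: dist_real_def)
  then obtain z where z: "t < z" "z < s" "f s - f t = (s - t) * f' z" by blast
  have "f' z < 0" using e'(2)[of "z - t"] z s f'(1) \<open>a = 0\<close> by simp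
  then have "f s < f t" using z s by (smt (verit) mult_pos_neg)
  then show False using e(2)[of s] s by (auto simp: dist_real_def)
qed

lemma DERIV_right_min_nonneg:
  fixes f :: "real \<Rightarrow> real"
  assumes "(f has_real_derivative a) (at t)" "\<forall>\<^sub>F s in at_right t. f t \<le> f s"
  shows "0 \<le> a"
proof (rule ccontr)
  assume "\<not> 0 \<le> a"
  then obtain e where e: "0 < e" "\<And>h. 0 < h \<Longrightarrow> h < e \<Longrightarrow> f (t + h) < f t"
    using DERIV_neg_dec_right[OF assms(1)] by auto
  obtain b where b: "t < b" "\<And>s. t < s \<Longrightarrow> s < b \<Longrightarrow> f t \<le> f s"
    using assms(2) by (auto simp: eventually_at_right_field)
  define h where "h = min e (b - t) / 2"
  have h: "0 < h" "h < e" "t + h < b" using e(1) b(1) by (auto simp: h_def min_def field_simps)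
  from e(2)[OF h(1,2)] b(2)[of "t + h"] h show False by simp
qed

lemma jet2_arccos:
  assumes "0 < r" "r < pi"
  shows "jet2 arccos (cos r) (- 1 / sin r) (- cos r / sin r ^ 3)"
proof (rule jet2I[where S="{-1<..<1}" and f'="\<lambda>z. - 1 / sqrt (1 - z\<^sup>2)"])
  have s: "0 < sin r" using assms by (intro sin_gt_zero)
  have c: "-1 < cos r" "cos r < 1"
    using cos_monotone_0_pi[of 0 r] cos_monotone_0_pi[of r pi] assms by auto
  then show "cos r \<in> {-1<..<1}" by simp
  have sq: "sqrt (1 - (cos r)\<^sup>2) = sin r"
    using s by (simp add: cos_squared_eq)
  show "- 1 / sqrt (1 - (cos r)\<^sup>2) = - 1 / sin r" by (simp add: sq)
  show "((\<lambda>z. - 1 / sqrt (1 - z\<^sup>2)) has_real_derivative - cos r / sin r ^ 3) (at (cos r))"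
    using s sq by (auto intro!: derivative_eq_intros simp: cos_squared_eq)
      (simp_all add: power3_eq_cube power2_eq_square divide_simps)
  fix z :: real assume "z \<in> {-1<..<1}"
  then show "(arccos has_real_derivative - 1 / sqrt (1 - z\<^sup>2)) (at z)"
    using DERIV_arccos[of z] by (simp add: inverse_eq_divide)
qed auto

section \<open>The Laplacian along great circles\<close>

text \<open>The geodesic from a unit vector \<open>x\<close> with tangent initial velocity
  \<open>w\<close>. The velocity is not normalised because projected basis vectors, which may
  vanish, are inserted for it; for \<open>w = 0\<close> the curve is constant.\<close>

definition great_circle :: "'a::euclidean_space \<Rightarrow> 'a \<Rightarrow> real \<Rightarrow> 'a" where
  "great_circle x w t = cos (norm w * t) *\<^sub>R x + (sin (norm w * t) / norm w) *\<^sub>R w"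

lemma great_circle_0 [simp]: "great_circle x w 0 = x"
  by (simp add: great_circle_def)

lemma great_circle_has_derivative:
  "(great_circle x w has_derivative
     (\<lambda>h. h *\<^sub>R ((- norm w * sin (norm w * t)) *\<^sub>R x + cos (norm w * t) *\<^sub>R w))) (at t)"
proof (cases "w = 0")
  case True
  then have "great_circle x w = (\<lambda>_. x)" by (simp add: great_circle_def fun_eq_iff)
  then show ?thesis using True by simp
next
  case False
  have "((\<lambda>t. cos (norm w * t)) has_real_derivative - norm w * sin (norm w * t)) (at t)"
    "((\<lambda>t. sin (norm w * t) / norm w) has_real_derivative cos (norm w * t)) (at t)"
    using False by (auto intro!: derivative_eq_intros)
  then have 1: "((\<lambda>t. cos (norm w * t)) has_derivative (*) (- norm w * sin (norm w * t))) (at t)"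
    "((\<lambda>t. sin (norm w * t) / norm w) has_derivative (*) (cos (norm w * t))) (at t)"
    unfolding has_field_derivative_def .
  show ?thesis unfolding great_circle_def[abs_def]
    by (rule derivative_eq_intros 1 refl)+ (simp add: scaleR_add_right algebra_simps)
qed

lemma norm_great_circle:
  assumes "norm x = 1" "x \<bullet> w = 0"
  shows "norm (great_circle x w t) = 1"
proof (cases "w = 0")
  case False
  have "x \<bullet> x = 1" using assms by (simp add: dot_square_norm)
  then have "great_circle x w t \<bullet> great_circle x w t
      = (cos (norm w * t))\<^sup>2 + (sin (norm w * t) / norm w)\<^sup>2 * (w \<bullet> w)"
    using assms(2) by (simp add: great_circle_def inner_add inner_commute power2_eq_square)
  also have "\<dots> = 1" using False by (simp add: dot_square_norm power_divide)
  finally show ?thesis by (simp add: norm_eq_1)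
qed (use assms in \<open>simp add: great_circle_def\<close>)

lemma isCont_great_circle: "isCont (great_circle x w) t"
  using great_circle_has_derivative by (rule has_derivative_continuous)

lemma jet2_inner_great_circle:
  "jet2 (\<lambda>t. v \<bullet> great_circle x w t) 0 (v \<bullet> w) (- (norm w)\<^sup>2 * (v \<bullet> x))"
proof (rule jet2I[where S=UNIV and
    f'="\<lambda>t. v \<bullet> ((- norm w * sin (norm w * t)) *\<^sub>R x + cos (norm w * t) *\<^sub>R w)"])
  show "((\<lambda>t. v \<bullet> great_circle x w t) has_real_derivative
     v \<bullet> ((- norm w * sin (norm w * t)) *\<^sub>R x + cos (norm w * t) *\<^sub>R w)) (at t)" for t
    using has_derivative_inner_right[OF great_circle_has_derivative, of v x w t]
    unfolding has_field_derivative_def inner_scaleR_right mult_commute_abs .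
  show "((\<lambda>t. v \<bullet> ((- norm w * sin (norm w * t)) *\<^sub>R x + cos (norm w * t) *\<^sub>R w))
     has_real_derivative - (norm w)\<^sup>2 * (v \<bullet> x)) (at 0)"
    unfolding inner_add_right inner_scaleR_right
    by (auto intro!: derivative_eq_intros simp: power2_eq_square)
qed auto

text \<open>The ambient second derivative in the directions \<open>v\<close> and \<open>w\<close>,
  in terms of partial derivatives because \<open>Ck_on\<close> grants differentiability for
  these.\<close>

definition hess :: "('a::euclidean_space \<Rightarrow> real) \<Rightarrow> 'a \<Rightarrow> 'a \<Rightarrow> 'a \<Rightarrow> real" where
  "hess u x v w = (\<Sum>b\<in>Basis. frechet_derivative (\<lambda>y. frechet_derivative u (at y) b) (at x) v * (w \<bullet> b))"

lemma smooth_on_derivatives: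
  assumes "smooth_on u U" "open U" "x \<in> U"
  shows "(u has_derivative frechet_derivative u (at x)) (at x)"
    "b \<in> Basis \<Longrightarrow> ((\<lambda>y. frechet_derivative u (at y) b) has_derivative
       frechet_derivative (\<lambda>y. frechet_derivative u (at y) b) (at x)) (at x)"
proof -
  have C: "Ck_on (Suc (Suc 0)) u U" using assms(1) unfolding smooth_on_def by blast
  have D: "(f has_derivative frechet_derivative f (at x)) (at x)" if "f differentiable_on U" for f :: "'a \<Rightarrow> real"
    using that assms(2,3) by (simp add: differentiable_on_eq_differentiable_at frechet_derivative_works)
  show "(u has_derivative frechet_derivative u (at x)) (at x)" using C by (auto intro: D)
  show "((\<lambda>y. frechet_derivative u (at y) b) has_derivative
       frechet_derivative (\<lambda>y. frechet_derivative u (at y) b) (at x)) (at x)" if "b \<in> Basis"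
    using C that by (auto intro: D)
qed

lemma smooth_on_linear:
  assumes "smooth_on u U" "open U" "x \<in> U"
  shows "linear (frechet_derivative u (at x))"
    "b \<in> Basis \<Longrightarrow> linear (frechet_derivative (\<lambda>y. frechet_derivative u (at y) b) (at x))"
  using smooth_on_derivatives[OF assms] by (blast intro: has_derivative_linear)+

lemma frechet_derivative_basis_sum:
  assumes "linear (D :: 'a::euclidean_space \<Rightarrow> real)"
  shows "D w = (\<Sum>b\<in>Basis. D b * (w \<bullet> b))"
proof -
  have "D w = D (\<Sum>b\<in>Basis. (w \<bullet> b) *\<^sub>R b)" by (simp add: euclidean_representation)
  also have "\<dots> = (\<Sum>b\<in>Basis. D b * (w \<bullet> b))"
    by (simp add: linear_sum[OF assms] linear_cmul[OF assms] mult.commute)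
  finally show ?thesis .
qed

text \<open>The term besides \<open>hess\<close> comes from the acceleration of the curve, which at
  time 0 is - |w|^2 x.\<close>

lemma jet2_smooth_great_circle:
  assumes "smooth_on u U" "open U" "x \<in> U"
  shows "jet2 (\<lambda>t. u (great_circle x w t)) 0 (frechet_derivative u (at x) w)
     (hess u x w w - (norm w)\<^sup>2 * frechet_derivative u (at x) x)"
proof -
  define c where "c = great_circle x w"
  define c' where "c' t = (- norm w * sin (norm w * t)) *\<^sub>R x + cos (norm w * t) *\<^sub>R w" for t
  have dc: "(c has_derivative (\<lambda>h. h *\<^sub>R c' t)) (at t)" for t
    unfolding c_def c'_def by (rule great_circle_has_derivative)
  have c0: "c 0 = x" "c' 0 = w" by (simp_all add: c_def c'_def)
  have "open (c -` U)"
    using assms(2) isCont_great_circle[where x=x and w=w]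
    by (intro open_vimage) (auto simp: c_def continuous_on_eq_continuous_at)
  have dU: "((\<lambda>t. f (c t)) has_real_derivative D (c' t)) (at t)"
    if "(f has_derivative D) (at (c t))" for f :: "'a \<Rightarrow> real" and D t
    using has_derivative_compose[OF dc that] linear_cmul[OF has_derivative_linear[OF that]]
    by (simp add: has_field_derivative_def mult_commute_abs)
  \<comment> \<open>Written out in partial derivatives, the first derivative is a sum of products,
    which the product rule can differentiate again.\<close>
  show ?thesis unfolding c_def[symmetric]
  proof (rule jet2I[where S="c -` U" and
        f'="\<lambda>t. \<Sum>b\<in>Basis. frechet_derivative u (at (c t)) b * (c' t \<bullet> b)"])
    show "open (c -` U)" by fact
    show "0 \<in> c -` U" using assms c0 by simp
    fix t assume t: "t \<in> c -` U"
    then have "c t \<in> U" by simp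
    from dU[OF smooth_on_derivatives(1)[OF assms(1,2) this]]
      frechet_derivative_basis_sum[OF smooth_on_linear(1)[OF assms(1,2) this], of "c' t"]
    show "((\<lambda>t. u (c t)) has_real_derivative
       (\<Sum>b\<in>Basis. frechet_derivative u (at (c t)) b * (c' t \<bullet> b))) (at t)" by simp
  next
    show "(\<Sum>b\<in>Basis. frechet_derivative u (at (c 0)) b * (c' 0 \<bullet> b)) = frechet_derivative u (at x) w"
      using frechet_derivative_basis_sum[OF smooth_on_linear(1)[OF assms], of w] c0 by simp
    have d: "((\<lambda>t. frechet_derivative u (at (c t)) b * (c' t \<bullet> b)) has_real_derivative
        frechet_derivative (\<lambda>y. frechet_derivative u (at y) b) (at x) w * (w \<bullet> b)
        + frechet_derivative u (at x) b * (- (norm w)\<^sup>2 * (x \<bullet> b))) (at 0)" if b: "b \<in> Basis" for b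
    proof -
      have "((\<lambda>y. frechet_derivative u (at y) b) has_derivative
         frechet_derivative (\<lambda>y. frechet_derivative u (at y) b) (at x)) (at (c 0))"
        using smooth_on_derivatives(2)[OF assms b] c0 by simp
      from dU[OF this] have 1: "((\<lambda>t. frechet_derivative u (at (c t)) b) has_real_derivative
          frechet_derivative (\<lambda>y. frechet_derivative u (at y) b) (at x) w) (at 0)"
        using c0 by simp
      have 2: "((\<lambda>t. c' t \<bullet> b) has_real_derivative - (norm w)\<^sup>2 * (x \<bullet> b)) (at 0)"
        unfolding c'_def inner_add_left inner_scaleR_left
        by (auto intro!: derivative_eq_intros simp: power2_eq_square)
      from DERIV_mult[OF 1 2] show ?thesis using c0 by (simp add: algebra_simps)
    qed
    have "((\<lambda>t. \<Sum>b\<in>Basis. frechet_derivative u (at (c t)) b * (c' t \<bullet> b)) has_real_derivative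
        (\<Sum>b\<in>Basis. frechet_derivative (\<lambda>y. frechet_derivative u (at y) b) (at x) w * (w \<bullet> b)
        + frechet_derivative u (at x) b * (- (norm w)\<^sup>2 * (x \<bullet> b)))) (at 0)"
      by (rule DERIV_sum) (rule d)
    also have "(\<Sum>b\<in>Basis. frechet_derivative (\<lambda>y. frechet_derivative u (at y) b) (at x) w * (w \<bullet> b)
        + frechet_derivative u (at x) b * (- (norm w)\<^sup>2 * (x \<bullet> b)))
      = hess u x w w - (norm w)\<^sup>2 * frechet_derivative u (at x) x"
      unfolding frechet_derivative_basis_sum[OF smooth_on_linear(1)[OF assms], of x]
      by (simp add: hess_def sum.distrib sum_subtractf sum_distrib_left sum_negf mult_ac)
    finally show "((\<lambda>t. \<Sum>b\<in>Basis. frechet_derivative u (at (c t)) b * (c' t \<bullet> b)) has_real_derivative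
       hess u x w w - (norm w)\<^sup>2 * frechet_derivative u (at x) x) (at 0)" .
  qed
qed

section \<open>The Laplacian as a sum over projected basis vectors\<close>

lemma tangent_proj_orthogonal:
  assumes "norm x = 1" shows "x \<bullet> tangent_proj x b = 0"
  using assms by (simp add: tangent_proj_def inner_diff_right dot_square_norm inner_commute)

lemma inner_tangent_proj: "v \<bullet> tangent_proj x b = tangent_proj x v \<bullet> b"
  by (simp add: tangent_proj_def inner_diff_right inner_diff_left inner_commute)

text \<open>Since the projection is self-adjoint, the left side is Parseval's sum for the inner
  product of the projections of v and w.\<close>

lemma sum_inner_tangent_proj:
  assumes "norm x = 1"
  shows "(\<Sum>b\<in>Basis. (v \<bullet> tangent_proj x b) * (w \<bullet> tangent_proj x b)) = v \<bullet> w - (v \<bullet> x) * (w \<bullet> x)"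
proof -
  have "x \<bullet> x = 1" using assms by (simp add: dot_square_norm)
  then show ?thesis
    unfolding inner_tangent_proj euclidean_inner[symmetric]
    by (simp add: tangent_proj_def inner_diff_right inner_diff_left inner_commute)
qed

text \<open>This is the trace of the orthogonal projection, hence the dimension of the tangent
  space.\<close>

lemma sum_norm_tangent_proj:
  assumes "norm (x::'a::euclidean_space) = 1"
  shows "(\<Sum>b\<in>Basis. (norm (tangent_proj x b))\<^sup>2) = real DIM('a) - 1"
proof -
  have x: "x \<bullet> x = 1" using assms by (simp add: dot_square_norm)
  have "(\<Sum>b\<in>Basis. (norm (tangent_proj x b))\<^sup>2) = (\<Sum>b\<in>Basis. 1 - (x \<bullet> b) * (x \<bullet> b))"
    by (intro sum.cong refl)
       (simp add: power2_norm_eq_inner tangent_proj_def inner_diff_right inner_diff_left inner_commute x)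
  also have "\<dots> = real DIM('a) - x \<bullet> x"
    by (simp add: sum_subtractf flip: euclidean_inner)
  finally show ?thesis using x by simp
qed

text \<open>By \<open>jet2_smooth_great_circle\<close>, each summand is the second derivative of
  \<open>u\<close> along the great circle with initial velocity \<open>tangent_proj x b\<close>.
  This reduces the Laplacian to calculus in one variable.\<close>

lemma sphere_laplacian_eq:
  assumes "smooth_on u U" "open U" "x \<in> U" "norm x = 1"
  shows "sphere_laplacian u x = (\<Sum>b\<in>Basis. hess u x (tangent_proj x b) (tangent_proj x b)
     - (norm (tangent_proj x b))\<^sup>2 * frechet_derivative u (at x) x)"
proof -
  let ?d = "\<lambda>b y. frechet_derivative u (at y) b"
  let ?D = "\<lambda>w. \<Sum>b\<in>Basis. ?d b x *\<^sub>R (- (b \<bullet> w) *\<^sub>R x - (b \<bullet> x) *\<^sub>R w)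
       + frechet_derivative (?d b) (at x) w *\<^sub>R tangent_proj x b"
  have "((\<lambda>y. \<Sum>b\<in>Basis. ?d b y *\<^sub>R tangent_proj y b) has_derivative ?D) (at x)"
  proof (rule has_derivative_sum)
    fix b :: 'a assume b: "b \<in> Basis"
    have "((\<lambda>y. tangent_proj y b) has_derivative (\<lambda>w. - (b \<bullet> w) *\<^sub>R x - (b \<bullet> x) *\<^sub>R w)) (at x)"
      unfolding tangent_proj_def by (auto intro!: derivative_eq_intros)
    from has_derivative_scaleR[OF smooth_on_derivatives(2)[OF assms(1-3) b] this]
    show "((\<lambda>y. ?d b y *\<^sub>R tangent_proj y b) has_derivative
       (\<lambda>w. ?d b x *\<^sub>R (- (b \<bullet> w) *\<^sub>R x - (b \<bullet> x) *\<^sub>R w)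
       + frechet_derivative (?d b) (at x) w *\<^sub>R tangent_proj x b)) (at x)" .
  qed
  then have G: "frechet_derivative (sphere_grad u) (at x) = ?D"
    unfolding sphere_grad_def[abs_def] by (rule frechet_derivative_at[symmetric])
  \<comment> \<open>Paired with a tangent w, the x-component in the derivative of the projection
    drops out; its w-component produces the term with \<open>(norm w)\<^sup>2\<close>.\<close>
  have "?D w \<bullet> w = hess u x w w - (norm w)\<^sup>2 * frechet_derivative u (at x) x" if w: "x \<bullet> w = 0" for w
  proof -
    have "?D w \<bullet> w = (\<Sum>b\<in>Basis. frechet_derivative (?d b) (at x) w * (w \<bullet> b)
        - (norm w)\<^sup>2 * (?d b x * (x \<bullet> b)))"
      unfolding inner_sum_left
      by (intro sum.cong refl)
         (simp add: inner_add_left inner_diff_left w w[unfolded inner_commute[of x]] tangent_proj_def power2_norm_eq_inner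
           inner_commute algebra_simps)
    also have "\<dots> = hess u x w w - (norm w)\<^sup>2 * frechet_derivative u (at x) x"
      unfolding frechet_derivative_basis_sum[OF smooth_on_linear(1)[OF assms(1-3)], of x]
      by (simp add: hess_def sum_subtractf sum_distrib_left)
    finally show ?thesis .
  qed
  then show ?thesis
    unfolding sphere_laplacian_def sphere_div_def G
    by (intro sum.cong refl) (simp add: tangent_proj_orthogonal[OF assms(4)])
qed

lemma sphere_grad_inner:
  assumes "smooth_on u U" "open U" "x \<in> U" "norm x = 1" "x \<bullet> w = 0"
  shows "sphere_grad u x \<bullet> w = frechet_derivative u (at x) w"
  unfolding sphere_grad_def inner_sum_left
    frechet_derivative_basis_sum[OF smooth_on_linear(1)[OF assms(1-3)], of w]
  using assms(5) by (simp add: tangent_proj_def inner_diff_left inner_commute[of _ w])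
    (simp add: inner_diff_left inner_commute[of w])

section \<open>Reflections and the Laplacian\<close>

text \<open>Expand \<open>f b\<close> in the basis and sum over b first: Parseval's identity
  collapses the coefficients to \<open>f c \<bullet> f d = c \<bullet> d\<close>. This is the
  invariance of the trace under an orthogonal change of basis.\<close>

lemma sum_bilinear_isometry:
  fixes B :: "'a::euclidean_space \<Rightarrow> 'a \<Rightarrow> real"
  assumes "bilinear B" and sym: "\<And>x y. f x \<bullet> y = x \<bullet> f y" and inv: "\<And>x. f (f x) = x"
  shows "(\<Sum>b\<in>Basis. B (f b) (f b)) = (\<Sum>b\<in>Basis. B b b)"
proof -
  have adj: "f b \<bullet> c = f c \<bullet> b" for b c using sym by (metis inner_commute)
  have "B (f b) (f b) = (\<Sum>(c, d)\<in>Basis \<times> Basis. (f c \<bullet> b) * (f d \<bullet> b) * B c d)" for b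
  proof -
    have "B (f b) (f b) = B (\<Sum>c\<in>Basis. (f b \<bullet> c) *\<^sub>R c) (\<Sum>c\<in>Basis. (f b \<bullet> c) *\<^sub>R c)"
      by (simp add: euclidean_representation)
    also have "\<dots> = (\<Sum>(c, d)\<in>Basis \<times> Basis. B ((f b \<bullet> c) *\<^sub>R c) ((f b \<bullet> d) *\<^sub>R d))"
      by (rule bilinear_sum[OF assms(1)])
    also have "\<dots> = (\<Sum>(c, d)\<in>Basis \<times> Basis. (f c \<bullet> b) * (f d \<bullet> b) * B c d)"
      by (intro sum.cong refl)
         (auto simp: bilinear_lmul[OF assms(1)] bilinear_rmul[OF assms(1)] adj[of b])
    finally show ?thesis .
  qed
  then have "(\<Sum>b\<in>Basis. B (f b) (f b)) =
      (\<Sum>b\<in>Basis. \<Sum>(c, d)\<in>Basis \<times> Basis. (f c \<bullet> b) * (f d \<bullet> b) * B c d)" by simp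
  also have "\<dots> = (\<Sum>(c, d)\<in>Basis \<times> Basis. (\<Sum>b\<in>Basis. (f c \<bullet> b) * (f d \<bullet> b)) * B c d)"
    by (subst sum.swap) (simp add: sum_distrib_right case_prod_unfold)
  also have "\<dots> = (\<Sum>(c, d)\<in>Basis \<times> Basis. (c \<bullet> d) * B c d)"
    unfolding euclidean_inner[symmetric] using sym inv by (metis (no_types, lifting))
  also have "\<dots> = (\<Sum>c\<in>Basis. \<Sum>d\<in>Basis. if c = d then B c d else 0)"
    unfolding sum.cartesian_product[symmetric] by (intro sum.cong refl) (auto simp: inner_Basis)
  also have "\<dots> = (\<Sum>b\<in>Basis. B b b)" by simp
  finally show ?thesis .
qed

definition reflect :: "'a::euclidean_space \<Rightarrow> 'a \<Rightarrow> 'a" where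
  "reflect e x = x - (2 * (e \<bullet> x)) *\<^sub>R e"

context
  fixes e :: "'a::euclidean_space"
  assumes e: "norm e = 1"
begin

lemma reflect_inner: "reflect e x \<bullet> y = x \<bullet> reflect e y"
  by (simp add: reflect_def inner_diff_left inner_diff_right inner_commute)

lemma reflect_reflect: "reflect e (reflect e x) = x"
  using e by (simp add: reflect_def inner_diff_right dot_square_norm algebra_simps)

lemma norm_reflect: "norm (reflect e x) = norm x"
  by (metis norm_eq_sqrt_inner reflect_inner reflect_reflect)

lemma linear_reflect: "linear (reflect e)"
  by (rule linearI) (simp_all add: reflect_def inner_add_right algebra_simps)

lemma reflect_great_circle:
  "reflect e (great_circle x w t) = great_circle (reflect e x) (reflect e w) t"
  unfolding great_circle_def norm_reflect
  by (simp add: linear_add[OF linear_reflect] linear_cmul[OF linear_reflect])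

lemma reflect_tangent_proj: "reflect e (tangent_proj x v) = tangent_proj (reflect e x) (reflect e v)"
  by (simp add: tangent_proj_def linear_diff[OF linear_reflect] linear_cmul[OF linear_reflect]
      reflect_inner reflect_reflect)

text \<open>The sum runs over the reflected tangent vectors of \<open>x\<close>, so that it matches,
  term by term, the second derivatives of u composed with the reflection along great circles from
  \<open>x\<close>.\<close>

lemma sphere_laplacian_reflect:
  assumes "smooth_on u U" "open U" "reflect e x \<in> U" "norm x = 1"
  shows "sphere_laplacian u (reflect e x) =
     (\<Sum>b\<in>Basis. hess u (reflect e x) (reflect e (tangent_proj x b)) (reflect e (tangent_proj x b))
        - (norm (tangent_proj x b))\<^sup>2 * frechet_derivative u (at (reflect e x)) (reflect e x))"
proof -
  let ?y = "reflect e x"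
  define B where "B v w = hess u ?y (tangent_proj ?y v) (tangent_proj ?y w)
     - (tangent_proj ?y v \<bullet> tangent_proj ?y w) * frechet_derivative u (at ?y) ?y" for v w
  have P: "linear (tangent_proj ?y)"
    by (rule linearI) (simp_all add: tangent_proj_def inner_add_left algebra_simps)
  note L = smooth_on_linear(2)[OF assms(1-3)]
  have "bilinear B"
    unfolding bilinear_def B_def hess_def
    by (intro conjI allI linearI)
       (simp_all add: linear_add[OF P] linear_cmul[OF P] linear_add[OF L] linear_cmul[OF L]
         inner_add_left inner_add_right sum.distrib sum_distrib_left algebra_simps)
  from sum_bilinear_isometry[OF this reflect_inner reflect_reflect]
  have "(\<Sum>b\<in>Basis. B b b) = (\<Sum>b\<in>Basis. B (reflect e b) (reflect e b))" by simp
  then show ?thesis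
    using assms norm_reflect
    by (subst sphere_laplacian_eq[OF assms(1-3)])
       (simp_all add: B_def power2_norm_eq_inner[symmetric] reflect_tangent_proj[symmetric] norm_reflect)
qed

end

section \<open>The odd part of an eigenfunction\<close>

lemma inner_bounds_unit:
  assumes "norm x = 1" "norm y = 1"
  shows "-1 \<le> x \<bullet> y" "x \<bullet> y \<le> 1"
  using Cauchy_Schwarz_ineq2[of x y] assms by auto

lemma cos_arccos_inner: "norm x = 1 \<Longrightarrow> norm y = 1 \<Longrightarrow> cos (arccos (x \<bullet> y)) = x \<bullet> y"
  using inner_bounds_unit[of x y] by (intro cos_arccos)

lemma inner_unit_eq_1_iff:
  assumes "norm x = 1" "norm y = 1"
  shows "x \<bullet> y = 1 \<longleftrightarrow> x = y"
proof
  assume "x \<bullet> y = 1"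
  have "(x - y) \<bullet> (x - y) = x \<bullet> x + y \<bullet> y - 2 * (x \<bullet> y)"
    by (simp add: inner_diff_left inner_diff_right inner_commute)
  also have "\<dots> = 0" using assms \<open>x \<bullet> y = 1\<close> by (simp add: dot_square_norm)
  finally have "(x - y) \<bullet> (x - y) = 0" .
  then show "x = y" by simp
qed (use assms in \<open>simp add: dot_square_norm\<close>)

lemma mem_geodesic_ball_iff:
  assumes "norm p = 1" "0 \<le> \<delta>" "\<delta> \<le> pi"
  shows "x \<in> geodesic_ball p \<delta> \<longleftrightarrow> norm x = 1 \<and> cos \<delta> \<le> p \<bullet> x"
proof (cases "norm x = 1")
  case True
  have "0 \<le> arccos (p \<bullet> x)" "arccos (p \<bullet> x) \<le> pi"
    using inner_bounds_unit[OF assms(1) True] by (simp_all add: arccos_lbound arccos_ubound)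
  from cos_mono_le_eq[OF assms(2,3) this]
  have "cos \<delta> \<le> cos (arccos (p \<bullet> x)) \<longleftrightarrow> arccos (p \<bullet> x) \<le> \<delta>" .
  then show ?thesis using True assms by (simp add: geodesic_ball_def cos_arccos_inner)
qed (simp add: geodesic_ball_def)

lemma compact_geodesic_ball:
  assumes "norm p = 1" "0 \<le> \<delta>" "\<delta> \<le> pi"
  shows "compact (geodesic_ball p \<delta>)"
proof -
  have "geodesic_ball p \<delta> = sphere 0 1 \<inter> {x. cos \<delta> \<le> p \<bullet> x}"
    by (intro set_eqI) (simp add: mem_geodesic_ball_iff[OF assms])
  moreover have "closed {x. cos \<delta> \<le> p \<bullet> x}"
    by (intro closed_Collect_le continuous_intros)
  ultimately show ?thesis by (simp add: compact_Int_closed)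
qed

lemma jet2_polar_angle:
  assumes "norm p = 1" "norm x = 1" "0 < r" "r < pi" "p \<bullet> x = cos r"
  shows "jet2 (\<lambda>t. arccos (p \<bullet> great_circle x w t)) 0 (- (p \<bullet> w) / sin r)
     ((norm w)\<^sup>2 * cos r / sin r - (p \<bullet> w)\<^sup>2 * cos r / sin r ^ 3)"
proof -
  have "jet2 arccos (p \<bullet> great_circle x w 0) (- 1 / sin r) (- cos r / sin r ^ 3)"
    using jet2_arccos[OF assms(3,4)] assms(5) by simp
  from jet2_compose[OF this jet2_inner_great_circle] show ?thesis
    by (simp add: assms(5) algebra_simps)
qed

text \<open>This is the Laplacian of a radial function f(r) with c1 = f' and c2 = f'': the gradient
  of r has length 1, and r has Laplacian (n - 1) cot r, where n - 1 = DIM - 2.\<close>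

lemma sum_radial_jet2:
  fixes x :: "'a::euclidean_space"
  assumes "norm p = 1" "norm x = 1" "0 < r" "r < pi" "p \<bullet> x = cos r"
  shows "(\<Sum>b\<in>Basis. c2 * (- (p \<bullet> tangent_proj x b) / sin r)\<^sup>2
      + c1 * ((norm (tangent_proj x b))\<^sup>2 * cos r / sin r - (p \<bullet> tangent_proj x b)\<^sup>2 * cos r / sin r ^ 3))
    = c2 + (real DIM('a) - 2) * (cos r / sin r) * c1"
proof -
  have s: "0 < sin r" using assms by (intro sin_gt_zero)
  have P: "(\<Sum>b\<in>Basis. (p \<bullet> tangent_proj x b)\<^sup>2) = (sin r)\<^sup>2"
    using sum_inner_tangent_proj[OF assms(2), of p p] assms
    by (simp add: power2_eq_square[symmetric] sin_squared_eq dot_square_norm)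
  have "(\<Sum>b\<in>Basis. c2 * (- (p \<bullet> tangent_proj x b) / sin r)\<^sup>2
      + c1 * ((norm (tangent_proj x b))\<^sup>2 * cos r / sin r - (p \<bullet> tangent_proj x b)\<^sup>2 * cos r / sin r ^ 3))
    = (\<Sum>b\<in>Basis. (c2 / (sin r)\<^sup>2 - c1 * cos r / sin r ^ 3) * (p \<bullet> tangent_proj x b)\<^sup>2
        + (c1 * cos r / sin r) * (norm (tangent_proj x b))\<^sup>2)"
    by (intro sum.cong refl) (simp add: power_divide algebra_simps)
  also have "\<dots> = (c2 / (sin r)\<^sup>2 - c1 * cos r / sin r ^ 3) * (sin r)\<^sup>2
       + (c1 * cos r / sin r) * (real DIM('a) - 1)"
    unfolding sum.distrib sum_distrib_left[symmetric] P sum_norm_tangent_proj[OF assms(2)] ..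
  also have "\<dots> = c2 + (real DIM('a) - 2) * (cos r / sin r) * c1"
    using s by (simp add: field_simps power2_eq_square power3_eq_cube)
  finally show ?thesis .
qed

lemma ex_small3:
  fixes a b c A B C :: real
  assumes "0 < a" "0 < b" "0 < c" "0 < A" "0 < B" "0 < C"
  obtains \<epsilon> where "0 < \<epsilon>" "\<epsilon> * A \<le> a" "\<epsilon> * B \<le> b" "\<epsilon> * C \<le> c"
proof -
  define \<epsilon> where "\<epsilon> = min (a / A) (min (b / B) (c / C))"
  have "\<epsilon> \<le> a / A" "\<epsilon> \<le> b / B" "\<epsilon> \<le> c / C" by (auto simp: \<epsilon>_def)
  then have "\<epsilon> * A \<le> a" "\<epsilon> * B \<le> b" "\<epsilon> * C \<le> c"
    using assms by (simp_all add: pos_le_divide_eq)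
  moreover have "0 < \<epsilon>" using assms by (simp add: \<epsilon>_def)
  ultimately show ?thesis by (intro that)
qed

text \<open>
  The last assumption is \<open>m \<le> mu_tilde (k + 2) \<delta>\<close>; it will be contradicted by showing that \<open>u\<close> vanishes.
\<close>

locale neumann_ball =
  fixes p :: "'a::euclidean_space" and k :: nat and \<delta> m :: real and u :: "'a \<Rightarrow> real" and U :: "'a set"
  assumes dim: "DIM('a) = k + 3" and p: "norm p = 1" and \<delta>: "0 < \<delta>" "\<delta> < pi / 2" and m: "0 < m"
    and U: "open U" "geodesic_ball p \<delta> \<subseteq> U" "smooth_on u U"
    and eigen: "\<And>x. x \<in> geodesic_ball p \<delta> \<Longrightarrow> - sphere_laplacian u x = m * u x"
    and neumann: "\<And>x. x \<in> geodesic_sphere p \<delta> \<Longrightarrow> sphere_grad u x \<bullet> outward_normal p \<delta> x = 0"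
    and m_le: "m \<le> real k + 2 + sin \<delta> ^ k * cos \<delta> / sin_int k \<delta>"
begin

lemma sin_cos_pos: "0 < sin \<delta>" "0 < cos \<delta>"
  using \<delta> by (auto intro!: sin_gt_zero cos_gt_zero_pi)

lemma ball_iff: "x \<in> geodesic_ball p \<delta> \<longleftrightarrow> norm x = 1 \<and> cos \<delta> \<le> p \<bullet> x"
  using \<delta> by (intro mem_geodesic_ball_iff p) auto

text \<open>Stated for the inward normal, since the great circle with this initial velocity enters
  the ball.\<close>

lemma normal_derivative:
  assumes "norm x = 1" "p \<bullet> x = cos \<delta>"
  shows "frechet_derivative u (at x) ((1 / sin \<delta>) *\<^sub>R (p - cos \<delta> *\<^sub>R x)) = 0"
proof -
  have x: "x \<in> geodesic_sphere p \<delta>"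
    using assms \<delta> by (simp add: geodesic_sphere_def arccos_cos)
  have "x \<in> geodesic_ball p \<delta>" using assms by (simp add: ball_iff)
  with U(2) have xU: "x \<in> U" by (rule subsetD)
  let ?\<nu> = "outward_normal p \<delta> x"
  have "x \<bullet> ?\<nu> = 0"
    using assms by (simp add: outward_normal_def inner_diff_right dot_square_norm inner_commute)
  from sphere_grad_inner[OF U(3,1) xU assms(1) this] neumann[OF x]
  have "frechet_derivative u (at x) ?\<nu> = 0" by simp
  moreover have "(1 / sin \<delta>) *\<^sub>R (p - cos \<delta> *\<^sub>R x) = - ?\<nu>"
    by (simp add: outward_normal_def scaleR_diff_right)
  ultimately show ?thesis
    using linear_neg[OF smooth_on_linear(1)[OF U(3,1) xU]] by simp
qed

text \<open>One inequality is enough, because exchanging the two points replaces e by - e. If it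
  failed, v / \<phi> would have a positive maximum M on the half ball, and M \<phi> - v a zero
  minimum; the minimum conditions contradict the strict inequalities for \<phi>, both inside and on
  the boundary.\<close>

lemma half_ball_comparison:
  assumes e: "norm e = 1" "e \<bullet> p = 0" and x1: "x1 \<in> geodesic_ball p \<delta>" "0 \<le> e \<bullet> x1"
  shows "u x1 \<le> u (reflect e x1)"
proof (rule ccontr)
  assume less: "\<not> ?thesis"
  define l where "l = sin \<delta> ^ k * cos \<delta> / sin_int k \<delta>"
  obtain L \<kappa> where L: "0 < \<kappa>" "0 < L" "barrier k L \<delta> < cos \<delta> / sin \<delta>"
    "\<And>r. 0 < r \<Longrightarrow> r \<le> \<delta> \<Longrightarrow>
       l + \<kappa> \<le> L + barrier k L r * (2 * (cos r / sin r) - barrier k L r)"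
    by (rule barrier_bounds[OF \<delta> l_def]) (rule that; assumption)
  \<comment> \<open>Going beyond \<delta> makes the equation for H available on an open interval
    around r even when r = \<delta>.\<close>
  define d where "d = (\<delta> + pi / 2) / 2"
  have d: "0 < d" "\<delta> < d" "d < pi / 2" using \<delta> by (auto simp: d_def)
  obtain H h where H: "continuous_on {0..d} H" "0 < h" "\<And>r. r \<in> {0..d} \<Longrightarrow> h \<le> H r"
    "\<And>r. 0 < r \<Longrightarrow> r \<le> d \<Longrightarrow> (H has_real_derivative - barrier k L r * H r) (at r)"
    by (rule barrier_exponential[OF d(1,3), of k L]) (rule that; assumption)
  let ?y = "barrier k L"
  let ?cot = "\<lambda>r. cos r / sin r"
  define c1 where "c1 = ?cot \<delta> - ?y \<delta>"
  have c1: "0 < c1" using L(3) by (simp add: c1_def)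
  have pos: "0 < \<kappa> * h" "0 < h * c1" "0 < m * (2 * real k + 6)" "0 < 4 * m * ?cot \<delta>"
    using L(1) H(2) c1 m sin_cos_pos by auto
  \<comment> \<open>In this order the bounds serve the positivity of \<phi>, the interior estimate,
    and the boundary estimate, which uses up half of the margin \<open>h * c1\<close>.\<close>
  obtain \<epsilon> where \<epsilon>: "0 < \<epsilon>" "\<epsilon> * m \<le> h" "\<epsilon> * (m * (2 * real k + 6)) \<le> \<kappa> * h"
      "\<epsilon> * (4 * m * ?cot \<delta>) \<le> h * c1"
    by (rule ex_small3[OF H(2) pos(1,2) m pos(3,4)])
  \<comment> \<open>The \<open>\<epsilon>\<close>-term makes \<open>\<phi>\<close> positive on the equator, where the odd function \<open>v\<close> vanishes. So the
    maximum of \<open>v / \<phi>\<close> lies off the equator, in particular away from the pole \<open>p\<close>, at which \<open>H\<close> need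
    not be smooth.\<close>
  define \<phi> where "\<phi> x = (e \<bullet> x) * H (arccos (p \<bullet> x)) + \<epsilon> * (1 - m * ((e \<bullet> x) * (e \<bullet> x)))" for x
  define v where "v x = u x - u (reflect e x)" for x
  define D where "D = {x \<in> geodesic_ball p \<delta>. 0 \<le> e \<bullet> x}"
  have reflect_p: "p \<bullet> reflect e x = p \<bullet> x" for x
    using e by (simp add: reflect_def inner_diff_right inner_commute)
  have reflect_ball: "reflect e x \<in> geodesic_ball p \<delta>" if "x \<in> geodesic_ball p \<delta>" for x
    using that by (simp add: ball_iff reflect_p norm_reflect[OF e(1)])
  have angle: "arccos (p \<bullet> x) \<in> {0..\<delta>}" if "x \<in> geodesic_ball p \<delta>" for x
    using that inner_bounds_unit[OF p, of x] by (auto simp: geodesic_ball_def intro: arccos_lbound)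
  have "D = geodesic_ball p \<delta> \<inter> {x. 0 \<le> e \<bullet> x}" by (auto simp: D_def)
  moreover have "closed {x. 0 \<le> e \<bullet> x}" by (intro closed_Collect_le continuous_intros)
  ultimately have "compact D"
    using \<delta> compact_geodesic_ball[OF p, of \<delta>] by (simp add: compact_Int_closed)
  have \<phi>_pos: "0 < \<phi> x" if "x \<in> D" for x
  proof -
    let ?a = "e \<bullet> x"
    have "norm x = 1" using that by (simp add: D_def ball_iff)
    then have a: "0 \<le> ?a" "?a \<le> 1" using that inner_bounds_unit[OF e(1), of x] by (auto simp: D_def)
    have "h \<le> H (arccos (p \<bullet> x))" using angle[of x] that d by (intro H(3)) (auto simp: D_def)
    then have "?a * h \<le> ?a * H (arccos (p \<bullet> x))" using a by (intro mult_left_mono)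
    moreover have "\<epsilon> * m * (?a * ?a) \<le> h * (?a * 1)"
      using a \<epsilon>(1,2) m H(2) by (intro mult_mono) auto
    ultimately show ?thesis using \<epsilon>(1) by (simp add: \<phi>_def algebra_simps)
  qed
  have cont_u: "continuous_on (geodesic_ball p \<delta>) u"
    using smooth_on_derivatives(1)[OF U(3,1) subsetD[OF U(2)]]
    by (intro continuous_at_imp_continuous_on ballI) (rule has_derivative_continuous)
  have DB: "D \<subseteq> geodesic_ball p \<delta>" by (auto simp: D_def)
  have cont_v: "continuous_on D v"
    unfolding v_def
    using reflect_ball DB
    by (intro continuous_on_diff continuous_on_subset[OF cont_u DB]
        continuous_on_compose2[OF cont_u] linear_continuous_on linear_conv_bounded_linear[THEN iffD1]
        linear_reflect[OF e(1)]) auto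
  have cont_angle: "continuous_on D (\<lambda>x. arccos (p \<bullet> x))"
    using inner_bounds_unit[OF p] by (intro continuous_on_arccos continuous_intros) (auto simp: D_def ball_iff)
  have cont_H: "continuous_on D (\<lambda>x. H (arccos (p \<bullet> x)))"
    by (rule continuous_on_compose2[OF H(1) cont_angle]) (use angle d in \<open>force simp: D_def\<close>)
  have "continuous_on D (\<lambda>x. v x / \<phi> x)"
  proof (intro continuous_on_divide cont_v)
    show "continuous_on D \<phi>" unfolding \<phi>_def by (intro continuous_intros cont_H)
  qed (use \<phi>_pos in force)
  moreover have x1D: "x1 \<in> D" using x1 by (simp add: D_def)
  ultimately have "\<exists>x0\<in>D. \<forall>x\<in>D. v x / \<phi> x \<le> v x0 / \<phi> x0"
    using \<open>compact D\<close> by (intro continuous_attains_sup) auto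
  then obtain x0 where x0: "x0 \<in> D" "\<And>x. x \<in> D \<Longrightarrow> v x / \<phi> x \<le> v x0 / \<phi> x0" by blast
  define M where "M = v x0 / \<phi> x0"
  have "0 < v x1 / \<phi> x1" using less \<phi>_pos[OF x1D] by (simp add: v_def)
  then have M: "0 < M" using x0(2)[OF x1D] by (simp add: M_def)
  have vM: "v x0 = M * \<phi> x0" using \<phi>_pos[OF x0(1)] by (simp add: M_def)
  have vle: "v x \<le> M * \<phi> x" if "x \<in> D" for x
    using x0(2)[OF that] \<phi>_pos[OF that] by (simp add: M_def[symmetric] pos_divide_le_eq)
  define \<alpha> where "\<alpha> = e \<bullet> x0"
  have nx0: "norm x0 = 1" and x0B: "x0 \<in> geodesic_ball p \<delta>" using x0 by (auto simp: D_def ball_iff)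
  have \<alpha>1: "\<alpha> \<le> 1" using inner_bounds_unit[OF e(1) nx0] by (simp add: \<alpha>_def)
  have \<alpha>0: "0 < \<alpha>"
  proof (rule ccontr)
    assume "\<not> 0 < \<alpha>"
    then have "e \<bullet> x0 = 0" using x0 by (simp add: D_def \<alpha>_def)
    then have "v x0 = 0" by (simp add: v_def reflect_def)
    then show False using vM M \<phi>_pos[OF x0(1)] by simp
  qed
  define r where "r = arccos (p \<bullet> x0)"
  have cosr: "p \<bullet> x0 = cos r" using cos_arccos_inner[OF p nx0] by (simp add: r_def)
  have r0: "0 \<le> r" and r\<delta>: "r \<le> \<delta>" using angle[OF x0B] by (auto simp: r_def)
  have "r \<noteq> 0"
  proof
    assume "r = 0"
    then have "p = x0" using cosr inner_unit_eq_1_iff[OF p nx0] by simp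
    then show False using \<alpha>0 e by (simp add: \<alpha>_def)
  qed
  with r0 have r0: "0 < r" by simp
  have rpi: "r < pi" "r < pi / 2" "r < d" using r\<delta> d \<delta> by auto
  have sr: "0 < sin r" using r0 rpi by (intro sin_gt_zero)
  define y where "y = ?y r"
  define y' where "y' = L - (real k + 1) * ?cot r * y"
  have Hh: "h \<le> H r" using H(3) r0 rpi by auto
  have jH: "jet2 H r (- y * H r) ((y\<^sup>2 - y') * H r)"
  proof (rule jet2I[where S="{0<..<d}" and f'="\<lambda>r. - ?y r * H r"])
    have "(?y has_real_derivative y') (at r)"
      unfolding y'_def y_def by (rule barrier_has_derivative[OF r0 rpi(2)])
    from DERIV_mult[OF DERIV_minus[OF this] H(4)[OF r0]] rpi
    show "((\<lambda>r. - ?y r * H r) has_real_derivative (y\<^sup>2 - y') * H r) (at r)"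
      by (simp add: y_def power2_eq_square algebra_simps)
  qed (use H(4) r0 rpi in \<open>auto simp: y_def\<close>)
  \<comment> \<open>Along the great circle from x0 with velocity w, \<open>r1\<close> and
    \<open>r2\<close> are the first two derivatives of the polar angle; \<open>F1\<close>,
    \<open>F2\<close> and \<open>V1\<close>, \<open>V2\<close> below are those of \<phi> and
    v.\<close>
  define r1 where "r1 w = - (p \<bullet> w) / sin r" for w
  define r2 where "r2 w = (norm w)\<^sup>2 * cos r / sin r - (p \<bullet> w)\<^sup>2 * cos r / sin r ^ 3" for w
  define F1 where "F1 w = (e \<bullet> w) * H r + \<alpha> * (- y * H r * r1 w) - \<epsilon> * m * (2 * \<alpha> * (e \<bullet> w))" for w
  define F2 where "F2 w = - (norm w)\<^sup>2 * \<alpha> * H r + 2 * (e \<bullet> w) * (- y * H r * r1 w)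
      + \<alpha> * ((y\<^sup>2 - y') * H r * (r1 w)\<^sup>2 + (- y * H r) * r2 w)
      - \<epsilon> * m * (2 * (e \<bullet> w)\<^sup>2 - 2 * (norm w)\<^sup>2 * \<alpha>\<^sup>2)" for w
  have j\<phi>: "jet2 (\<lambda>t. \<phi> (great_circle x0 w t)) 0 (F1 w) (F2 w)" for w
  proof -
    have jA: "jet2 (\<lambda>t. e \<bullet> great_circle x0 w t) 0 (e \<bullet> w) (- (norm w)\<^sup>2 * \<alpha>)"
      unfolding \<alpha>_def by (rule jet2_inner_great_circle)
    have jR: "jet2 (\<lambda>t. arccos (p \<bullet> great_circle x0 w t)) 0 (r1 w) (r2 w)"
      unfolding r1_def r2_def by (rule jet2_polar_angle[OF p nx0 r0 rpi(1) cosr])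
    have "jet2 H (arccos (p \<bullet> great_circle x0 w 0)) (- y * H r) ((y\<^sup>2 - y') * H r)"
      using jH by (simp add: r_def)
    from jet2_mult[OF jA jet2_compose[OF this jR]]
      jet2_cmult[OF jet2_diff[OF jet2_const jet2_cmult[OF jet2_mult[OF jA jA], of m], of 1], of \<epsilon>]
    have "jet2 (\<lambda>t. \<phi> (great_circle x0 w t)) 0
      ((e \<bullet> w) * H r + \<alpha> * (- y * H r * r1 w) + \<epsilon> * (0 - m * ((e \<bullet> w) * \<alpha> + \<alpha> * (e \<bullet> w))))
      (- (norm w)\<^sup>2 * \<alpha> * H r + 2 * (e \<bullet> w) * (- y * H r * r1 w)
      + \<alpha> * ((y\<^sup>2 - y') * H r * (r1 w)\<^sup>2 + (- y * H r) * r2 w)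
      + \<epsilon> * (0 - m * (- (norm w)\<^sup>2 * \<alpha> * \<alpha> + 2 * (e \<bullet> w) * (e \<bullet> w) + \<alpha> * (- (norm w)\<^sup>2 * \<alpha>))))"
      unfolding \<phi>_def great_circle_0 \<alpha>_def[symmetric] r_def[symmetric] by (rule jet2_add)
    also have "((e \<bullet> w) * H r + \<alpha> * (- y * H r * r1 w) + \<epsilon> * (0 - m * ((e \<bullet> w) * \<alpha> + \<alpha> * (e \<bullet> w)))) = F1 w"
      by (simp add: F1_def)
    also have "(- (norm w)\<^sup>2 * \<alpha> * H r + 2 * (e \<bullet> w) * (- y * H r * r1 w)
      + \<alpha> * ((y\<^sup>2 - y') * H r * (r1 w)\<^sup>2 + (- y * H r) * r2 w)
      + \<epsilon> * (0 - m * (- (norm w)\<^sup>2 * \<alpha> * \<alpha> + 2 * (e \<bullet> w) * (e \<bullet> w) + \<alpha> * (- (norm w)\<^sup>2 * \<alpha>)))) = F2 w"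
      by (simp add: F2_def power2_eq_square algebra_simps)
    finally show ?thesis .
  qed
  let ?x0' = "reflect e x0"
  have xU: "x0 \<in> U" "?x0' \<in> U" using subsetD[OF U(2)] x0B reflect_ball by simp_all
  define V1 where "V1 w = frechet_derivative u (at x0) w - frechet_derivative u (at ?x0') (reflect e w)" for w
  define V2 where "V2 w = (hess u x0 w w - (norm w)\<^sup>2 * frechet_derivative u (at x0) x0)
     - (hess u ?x0' (reflect e w) (reflect e w) - (norm w)\<^sup>2 * frechet_derivative u (at ?x0') ?x0')" for w
  have jv: "jet2 (\<lambda>t. v (great_circle x0 w t)) 0 (V1 w) (V2 w)" for w
    using jet2_diff[OF jet2_smooth_great_circle[OF U(3,1) xU(1), of w]
        jet2_smooth_great_circle[OF U(3,1) xU(2), of "reflect e w"]]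
    by (simp add: v_def V1_def V2_def reflect_great_circle[OF e(1)] norm_reflect[OF e(1)])
  have j\<psi>: "jet2 (\<lambda>t. M * \<phi> (great_circle x0 w t) - v (great_circle x0 w t)) 0 (M * F1 w - V1 w) (M * F2 w - V2 w)" for w
    by (intro jet2_diff jet2_cmult j\<phi> jv)
  have tend: "((\<lambda>t. q \<bullet> great_circle x0 w t) \<longlongrightarrow> q \<bullet> x0) (nhds 0)" for q w
  proof -
    have "isCont (\<lambda>t. q \<bullet> great_circle x0 w t) 0"
      by (intro continuous_intros isCont_great_circle)
    then show ?thesis
      using tendsto_at_iff_tendsto_nhds[of "\<lambda>t. q \<bullet> great_circle x0 w t" 0] by (simp add: isCont_def)
  qed
  have ev_e: "\<forall>\<^sub>F t in nhds 0. 0 < e \<bullet> great_circle x0 w t" for w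
    using order_tendstoD(1)[OF tend] \<alpha>0 by (simp add: \<alpha>_def)
  show False
  proof (cases "r = \<delta>")
    case True
    \<comment> \<open>At a boundary point only inward curves stay in D. Along the inward normal w
      the derivative of v vanishes, by the Neumann condition at x0 and at its mirror image, whereas
      \<phi> decreases because the barrier is below cot at \<delta>.\<close>
    define w where "w = (1 / sin \<delta>) *\<^sub>R (p - cos \<delta> *\<^sub>R x0)"
    have pw: "p \<bullet> w = sin \<delta>"
      using cosr True sin_cos_pos p
      by (simp add: w_def inner_diff_right dot_square_norm cos_squared_eq field_simps power2_eq_square[symmetric])
    have xw: "x0 \<bullet> w = 0"
      using cosr True nx0 by (simp add: w_def inner_diff_right dot_square_norm inner_commute)
    have "w \<bullet> q = (1 / sin \<delta>) * (p \<bullet> q - cos \<delta> * (x0 \<bullet> q))" for q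
      by (simp add: w_def inner_diff_left)
    from this[of w] have nw: "norm w = 1" using pw xw sin_cos_pos by (simp add: norm_eq_1)
    have ew: "e \<bullet> w = - ?cot \<delta> * \<alpha>"
      using e by (simp add: w_def inner_diff_right \<alpha>_def)
    have "reflect e p = p" using e by (simp add: reflect_def)
    then have "reflect e w = (1 / sin \<delta>) *\<^sub>R (p - cos \<delta> *\<^sub>R ?x0')"
      by (simp add: w_def linear_cmul[OF linear_reflect[OF e(1)]] linear_diff[OF linear_reflect[OF e(1)]])
    then have V0: "V1 w = 0"
      using normal_derivative[of x0] normal_derivative[of ?x0'] nx0 cosr True
      by (simp add: V1_def w_def[symmetric] norm_reflect[OF e(1)] reflect_p)
    have "\<forall>\<^sub>F t in at_right 0. great_circle x0 w t \<in> D"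
    proof -
      have "\<forall>\<^sub>F t in at_right 0. t < \<delta>" "\<forall>\<^sub>F t in at_right (0::real). 0 < t"
        using \<delta> by (auto simp: eventually_at_right_less eventually_at_right_field)
      moreover have "\<forall>\<^sub>F t in at_right 0. 0 < e \<bullet> great_circle x0 w t"
        using ev_e[of w] by (simp add: eventually_at_filter eventually_mono)
      ultimately show ?thesis
      proof eventually_elim
        case (elim t)
        have "p \<bullet> great_circle x0 w t = cos (\<delta> - t)"
          using nw pw cosr True by (simp add: great_circle_def inner_add_right cos_diff mult.commute)
        also have "\<dots> \<ge> cos \<delta>" using elim \<delta> by (intro cos_monotone_0_pi_le) auto
        finally show ?case
          using norm_great_circle[OF nx0 xw, of t] elim by (simp add: D_def ball_iff)
      qed
    qed
    then have "\<forall>\<^sub>F t in at_right 0. M * \<phi> (great_circle x0 w 0) - v (great_circle x0 w 0)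
         \<le> M * \<phi> (great_circle x0 w t) - v (great_circle x0 w t)"
      by eventually_elim (use vle vM in simp)
    from DERIV_right_min_nonneg[OF jet2_DERIV[OF j\<psi>] this] have "0 \<le> M * F1 w" using V0 by simp
    then have "0 \<le> F1 w" using M by (simp add: zero_le_mult_iff)
    also have "F1 w = \<alpha> * (- H r * c1 + 2 * (\<epsilon> * m * ?cot \<delta>) * \<alpha>)"
      using True sin_cos_pos pw
      by (simp add: F1_def ew r1_def c1_def y_def algebra_simps)
    finally have "H r * c1 \<le> 2 * (\<epsilon> * m * ?cot \<delta>) * \<alpha>"
      using \<alpha>0 by (simp add: zero_le_mult_iff)
    also have "\<dots> \<le> 2 * (\<epsilon> * m * ?cot \<delta>) * 1"
      using \<epsilon>(1) m sin_cos_pos \<alpha>1 by (intro mult_left_mono) auto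
    also have "\<dots> \<le> h * c1 / 2" using \<epsilon>(4) by (simp add: algebra_simps)
    also have "\<dots> < h * c1" using H(2) c1 by simp
    also have "\<dots> \<le> H r * c1" using Hh c1 by (intro mult_right_mono) auto
    finally show False by simp
  next
    case False
    then have "cos \<delta> < p \<bullet> x0"
      using r\<delta> r0 \<delta> unfolding cosr by (intro cos_monotone_0_pi) auto
    then have ev_p: "\<forall>\<^sub>F t in nhds 0. cos \<delta> < p \<bullet> great_circle x0 w t" for w
      using order_tendstoD(1)[OF tend] by blast
    let ?P = "tangent_proj x0"
    have "0 \<le> M * F2 (?P b) - V2 (?P b)" for b
    proof -
      have "\<forall>\<^sub>F t in nhds 0. great_circle x0 (?P b) t \<in> D"
        using ev_e[of "?P b"] ev_p[of "?P b"]
        by eventually_elim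
           (simp add: D_def ball_iff norm_great_circle[OF nx0 tangent_proj_orthogonal[OF nx0]])
      then have "\<forall>\<^sub>F t in nhds 0. M * \<phi> (great_circle x0 (?P b) 0) - v (great_circle x0 (?P b) 0)
         \<le> M * \<phi> (great_circle x0 (?P b) t) - v (great_circle x0 (?P b) t)"
        by eventually_elim (use vle vM in simp)
      from jet2_min_nonneg[OF j\<psi> this] show ?thesis .
    qed
    \<comment> \<open>Summed over the basis, the second-order conditions and the eigenvalue equation
      say that the Laplacian of \<phi> plus m \<phi> is nonnegative at x0; the rest refutes
      this.\<close>
    then have "0 \<le> (\<Sum>b\<in>Basis. M * F2 (?P b) - V2 (?P b))" by (intro sum_nonneg)
    also have "\<dots> = M * (\<Sum>b\<in>Basis. F2 (?P b)) - (\<Sum>b\<in>Basis. V2 (?P b))"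
      by (simp add: sum_subtractf sum_distrib_left)
    also have "(\<Sum>b\<in>Basis. V2 (?P b)) = sphere_laplacian u x0 - sphere_laplacian u ?x0'"
      unfolding sphere_laplacian_eq[OF U(3,1) xU(1) nx0] sphere_laplacian_reflect[OF e(1) U(3,1) xU(2) nx0]
      by (simp add: V2_def sum_subtractf)
    also have "\<dots> = - m * v x0"
      using eigen[OF x0B] eigen[OF reflect_ball[OF x0B]] by (simp add: v_def algebra_simps)
    also have "M * (\<Sum>b\<in>Basis. F2 (?P b)) - (- m * v x0) = M * ((\<Sum>b\<in>Basis. F2 (?P b)) + m * \<phi> x0)"
      by (simp add: vM algebra_simps)
    finally have "0 \<le> (\<Sum>b\<in>Basis. F2 (?P b)) + m * \<phi> x0" using M by (simp add: zero_le_mult_iff)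
    have S1: "(\<Sum>b\<in>Basis. (norm (?P b))\<^sup>2) = real k + 2"
      using sum_norm_tangent_proj[OF nx0] dim by simp
    have S2: "(\<Sum>b\<in>Basis. (e \<bullet> ?P b) * r1 (?P b)) = \<alpha> * ?cot r"
      using sum_inner_tangent_proj[OF nx0, of e p] e sr
      by (simp add: r1_def sum_negf sum_divide_distrib[symmetric] \<alpha>_def cosr)
    have S3: "(\<Sum>b\<in>Basis. (e \<bullet> ?P b)\<^sup>2) = 1 - \<alpha>\<^sup>2"
      using sum_inner_tangent_proj[OF nx0, of e e] e
      by (simp add: power2_eq_square \<alpha>_def dot_square_norm)
    have S4: "(\<Sum>b\<in>Basis. (y\<^sup>2 - y') * H r * (r1 (?P b))\<^sup>2 + (- y * H r) * r2 (?P b))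
        = (y\<^sup>2 - y') * H r + (real k + 1) * ?cot r * (- y * H r)"
      unfolding r1_def r2_def sum_radial_jet2[OF p nx0 r0 rpi(1) cosr] using dim by simp
    have "(\<Sum>b\<in>Basis. F2 (?P b)) = (\<Sum>b\<in>Basis. - \<alpha> * H r * (norm (?P b))\<^sup>2
        + (- 2 * y * H r) * ((e \<bullet> ?P b) * r1 (?P b))
        + \<alpha> * ((y\<^sup>2 - y') * H r * (r1 (?P b))\<^sup>2 + (- y * H r) * r2 (?P b))
        - (2 * \<epsilon> * m * (e \<bullet> ?P b)\<^sup>2 - 2 * \<epsilon> * m * \<alpha>\<^sup>2 * (norm (?P b))\<^sup>2))"
      by (intro sum.cong refl) (simp add: F2_def algebra_simps)
    also have "\<dots> = - \<alpha> * H r * (real k + 2) + (- 2 * y * H r) * (\<alpha> * ?cot r)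
        + \<alpha> * ((y\<^sup>2 - y') * H r + (real k + 1) * ?cot r * (- y * H r))
        - (2 * \<epsilon> * m * (1 - \<alpha>\<^sup>2) - 2 * \<epsilon> * m * \<alpha>\<^sup>2 * (real k + 2))"
      unfolding sum.distrib sum_subtractf sum_distrib_left[symmetric] S1 S2 S3
        S4[unfolded sum.distrib sum_distrib_left[symmetric]] ..
    \<comment> \<open>The equation of the barrier cancels the terms with k + 1. The number 2 k + 6 =
      2 (n + 1) arises since (e \<bullet> x)^2 has Laplacian 2 - 2 (n + 1) (e \<bullet>
      x)^2.\<close>
    also have "\<dots> = - \<alpha> * H r * (real k + 2 + (L + y * (2 * ?cot r - y)))
        - \<epsilon> * m * (2 - (2 * real k + 6) * \<alpha>\<^sup>2)"
    proof -
      have "- \<alpha> * h * (real k + 2) + (- 2 * y * h) * (\<alpha> * q)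
          + \<alpha> * ((y\<^sup>2 - (L - (real k + 1) * q * y)) * h + (real k + 1) * q * (- y * h))
          - (2 * \<epsilon> * m * (1 - \<alpha>\<^sup>2) - 2 * \<epsilon> * m * \<alpha>\<^sup>2 * (real k + 2))
        = - \<alpha> * h * (real k + 2 + (L + y * (2 * q - y)))
          - \<epsilon> * m * (2 - (2 * real k + 6) * \<alpha>\<^sup>2)" for h q
        by (simp add: power2_eq_square algebra_simps)
      then show ?thesis unfolding y'_def .
    qed
    finally have sumF: "(\<Sum>b\<in>Basis. F2 (?P b)) = \<dots>" .
    have "m + \<kappa> \<le> real k + 2 + (L + y * (2 * ?cot r - y))"
      using L(4)[OF r0 r\<delta>] m_le by (simp add: l_def y_def)
    then have "\<alpha> * H r * (m + \<kappa>) \<le> \<alpha> * H r * (real k + 2 + (L + y * (2 * ?cot r - y)))"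
      using \<alpha>0 Hh H(2) by (intro mult_left_mono) auto
    with \<open>0 \<le> _ + m * \<phi> x0\<close> sumF
    have "0 \<le> - \<alpha> * H r * (m + \<kappa>) - \<epsilon> * m * (2 - (2 * real k + 6) * \<alpha>\<^sup>2) + m * \<phi> x0"
      by simp
    also have "\<dots> = - \<alpha> * (H r * \<kappa>) - \<epsilon> * m + \<epsilon> * (m * (2 * real k + 6)) * \<alpha>\<^sup>2 - \<epsilon> * m * m * \<alpha>\<^sup>2"
      by (simp add: \<phi>_def \<alpha>_def[symmetric] r_def[symmetric] power2_eq_square algebra_simps)
    \<comment> \<open>The constant part of the \<epsilon>-term is - 2 m + m = - m, of the right
      sign; its positive quadratic part is absorbed by \<kappa>, as \<alpha>^2 is at most
      \<alpha>.\<close>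
    also have "\<dots> < - \<alpha> * (H r * \<kappa>) + \<epsilon> * (m * (2 * real k + 6)) * \<alpha>\<^sup>2"
    proof -
      have "0 < \<epsilon> * m" "0 \<le> \<epsilon> * m * m * \<alpha>\<^sup>2" using \<epsilon>(1) m by auto
      then show ?thesis by simp
    qed
    also have "\<epsilon> * (m * (2 * real k + 6)) * \<alpha>\<^sup>2 \<le> (\<kappa> * h) * \<alpha>"
    proof (rule mult_mono[OF \<epsilon>(3)])
      show "\<alpha>\<^sup>2 \<le> \<alpha>" using mult_left_mono[OF \<alpha>1, of \<alpha>] \<alpha>0 by (simp add: power2_eq_square)
    qed (use L(1) H(2) in auto)
    also have "\<dots> \<le> \<alpha> * (H r * \<kappa>)"
      using Hh \<alpha>0 L(1) by (simp add: mult_ac mult_left_mono)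
    finally show False by simp
  qed
qed

end

section \<open>Radial eigenfunctions\<close>

text \<open>Near t the hidden derivative function of the jet at t must agree with
  \<open>g\<close>.\<close>

lemma jet2_family_DERIV:
  assumes "open S" "t \<in> S" "\<And>s. s \<in> S \<Longrightarrow> jet2 f s (g s) (g' s)"
  shows "(g has_real_derivative g' t) (at t)"
proof -
  obtain f' where f': "f' t = g t" "\<forall>\<^sub>F s in nhds t. (f has_real_derivative f' s) (at s)"
     "(f' has_real_derivative g' t) (at t)"
    using assms(3)[OF assms(2)] by (auto simp: jet2_def)
  have "\<forall>\<^sub>F s in nhds t. s \<in> S" using assms(1,2) by (rule eventually_nhds_in_open)
  with f'(2) have "\<forall>\<^sub>F s in nhds t. f' s = g s"
    by eventually_elim (rule DERIV_unique[OF _ jet2_DERIV[OF assms(3)]])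
  then show ?thesis using f'(3) by (rule iffD1[OF DERIV_cong_ev[OF refl _ refl]])
qed

lemma DERIV_eq_0_if_locally_const:
  fixes f :: "real \<Rightarrow> real"
  assumes "(f has_real_derivative D) (at t)" "open S" "t \<in> S" "\<And>s. s \<in> S \<Longrightarrow> f s = c"
  shows "D = 0"
proof -
  have "\<forall>\<^sub>F s in nhds t. s \<in> S" using assms(2,3) by (rule eventually_nhds_in_open)
  then have "\<forall>\<^sub>F s in nhds t. f s = c" by eventually_elim (rule assms(4))
  then have "((\<lambda>_. c) has_real_derivative D) (at t)"
    using assms(1) by (rule iffD1[OF DERIV_cong_ev[OF refl _ refl]])
  then show ?thesis using DERIV_const by (rule DERIV_unique)
qed

text \<open>Equal norms mean that the hyperplane bisecting the segment from x to y passes through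
  the origin.\<close>

lemma reflect_swap:
  assumes "norm x = norm y" "x \<noteq> y"
  shows "reflect ((1 / norm (x - y)) *\<^sub>R (x - y)) x = y"
proof -
  define d where "d = x - y"
  have d: "norm d \<noteq> 0" using assms by (simp add: d_def)
  have "x \<bullet> x = y \<bullet> y" using assms by (simp add: dot_square_norm)
  then have "2 * (d \<bullet> x) = d \<bullet> d"
    by (simp add: d_def inner_diff_left inner_diff_right inner_commute)
  then have "2 * (d \<bullet> x) = norm d * norm d" by (simp add: dot_square_norm power2_eq_square)
  then have "reflect ((1 / norm d) *\<^sub>R d) x = x - d"
    using d by (simp add: reflect_def)
  then show ?thesis by (simp add: d_def)
qed

context neumann_ball
begin

text \<open>Here f is u along a meridian \<gamma> through the pole, and the equation is the
  eigenvalue equation in polar form.\<close>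

lemma radial_ode:
  assumes rad: "\<And>x y. x \<in> geodesic_ball p \<delta> \<Longrightarrow> y \<in> geodesic_ball p \<delta> \<Longrightarrow> p \<bullet> x = p \<bullet> y \<Longrightarrow> u x = u y"
  obtains f g where "\<And>x. x \<in> geodesic_ball p \<delta> \<Longrightarrow> u x = f (arccos (p \<bullet> x))"
    "\<And>r. r \<in> {0..\<delta>} \<Longrightarrow> (f has_real_derivative g r) (at r)"
    "\<And>r. r \<in> {0..\<delta>} \<Longrightarrow> isCont g r"
    "\<And>r. r \<in> {0<..<\<delta>} \<Longrightarrow> (g has_real_derivative - (real k + 1) * (cos r / sin r) * g r - m * f r) (at r)"
    "g 0 = 0" "g \<delta> = 0"
proof -
  obtain q0 where q0: "q0 \<noteq> 0" "orthogonal p q0"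
    using orthogonal_to_vector_exists[of p] dim by auto
  define q where "q = (1 / norm q0) *\<^sub>R q0"
  have q: "norm q = 1" "p \<bullet> q = 0" using q0 by (auto simp: q_def orthogonal_def)
  define \<gamma> where "\<gamma> = great_circle p q"
  define \<gamma>' where "\<gamma>' r = - sin r *\<^sub>R p + cos r *\<^sub>R q" for r
  have \<gamma>_eq: "\<gamma> r = cos r *\<^sub>R p + sin r *\<^sub>R q" for r
    by (simp add: \<gamma>_def great_circle_def q)
  have p\<gamma>: "p \<bullet> \<gamma> r = cos r" for r using p q by (simp add: \<gamma>_eq inner_add_right dot_square_norm)
  have n\<gamma>: "norm (\<gamma> r) = 1" for r unfolding \<gamma>_def using p q by (intro norm_great_circle)
  have "\<gamma>' r \<bullet> \<gamma>' r = (sin r)\<^sup>2 + (cos r)\<^sup>2" for r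
    unfolding \<gamma>'_def inner_add_left inner_add_right inner_scaleR_left inner_scaleR_right
    using p q by (simp add: dot_square_norm inner_commute power2_eq_square)
  then have n\<gamma>': "norm (\<gamma>' r) = 1" for r by (simp add: norm_eq_1)
  \<comment> \<open>Restarting the meridian at time r yields the same curve, so jets at time 0 give
    jets at every r.\<close>
  have shift: "great_circle (\<gamma> r) (\<gamma>' r) t = \<gamma> (r + t)" for r t
    unfolding great_circle_def n\<gamma>'
    by (simp add: \<gamma>_eq \<gamma>'_def cos_add sin_add algebra_simps)
  have \<gamma>_ball: "\<gamma> r \<in> geodesic_ball p \<delta>" if "\<bar>r\<bar> \<le> \<delta>" for r
  proof -
    have "cos \<delta> \<le> cos \<bar>r\<bar>" using that \<delta> by (intro cos_monotone_0_pi_le) auto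
    then show ?thesis by (simp add: ball_iff p\<gamma> n\<gamma>)
  qed
  define f where "f r = u (\<gamma> r)" for r
  define g where "g r = frechet_derivative u (at (\<gamma> r)) (\<gamma>' r)" for r
  define g' where "g' r = hess u (\<gamma> r) (\<gamma>' r) (\<gamma>' r)
     - (norm (\<gamma>' r))\<^sup>2 * frechet_derivative u (at (\<gamma> r)) (\<gamma> r)" for r
  define S where "S = \<gamma> -` U"
  have "open S"
    unfolding S_def using U(1) isCont_great_circle[where x=p and w=q]
    by (intro open_vimage) (auto simp: \<gamma>_def continuous_on_eq_continuous_at)
  have S: "r \<in> S" if "\<bar>r\<bar> \<le> \<delta>" for r
    using subsetD[OF U(2) \<gamma>_ball[OF that]] by (simp add: S_def)
  have jf: "jet2 f r (g r) (g' r)" if "r \<in> S" for r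
  proof -
    have "jet2 (\<lambda>t. f (r + t)) 0 (g r) (g' r)"
      using jet2_smooth_great_circle[OF U(3,1), of "\<gamma> r" "\<gamma>' r"] that
      by (simp add: S_def shift f_def g_def g'_def)
    then have 1: "jet2 (\<lambda>t. f (r + t)) (r - r) (g r) (g' r)" by simp
    have 2: "jet2 (\<lambda>s. s - r) r 1 0"
      by (rule jet2I[where S=UNIV and f'="\<lambda>_. 1"]) (auto intro!: derivative_eq_intros)
    from jet2_compose[of "\<lambda>t. f (r + t)" "\<lambda>s. s - r" r, OF 1 2] show ?thesis by simp
  qed
  have Df: "(f has_real_derivative g r) (at r)" if "r \<in> S" for r
    using jf[OF that] by (rule jet2_DERIV)
  have Dg: "(g has_real_derivative g' r) (at r)" if "r \<in> S" for r
    using \<open>open S\<close> that jf by (rule jet2_family_DERIV)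
  have uf: "u x = f (arccos (p \<bullet> x))" if x: "x \<in> geodesic_ball p \<delta>" for x
  proof -
    have nx: "norm x = 1" using x by (simp add: ball_iff)
    have a: "arccos (p \<bullet> x) \<le> \<delta>" "0 \<le> arccos (p \<bullet> x)"
      using x inner_bounds_unit[OF p nx] by (auto simp: geodesic_ball_def intro: arccos_lbound)
    show ?thesis unfolding f_def
      using a by (intro rad x \<gamma>_ball) (auto simp: p\<gamma> cos_arccos_inner[OF p nx])
  qed
  have ode: "g' r = - (real k + 1) * (cos r / sin r) * g r - m * f r" if r: "r \<in> {0<..<\<delta>}" for r
  proof -
    let ?x = "\<gamma> r" let ?P = "tangent_proj ?x"
    have xB: "?x \<in> geodesic_ball p \<delta>" using r by (intro \<gamma>_ball) auto
    have rS: "r \<in> S" using r by (intro S) auto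
    then have xU: "?x \<in> U" by (simp add: S_def)
    have r': "0 < r" "r < pi" using r \<delta> by auto
    \<comment> \<open>The second derivative of u along a great circle is computed twice: by the
      ambient formula, and by the chain rule through f of the polar angle.\<close>
    have eq: "hess u ?x (?P b) (?P b) - (norm (?P b))\<^sup>2 * frechet_derivative u (at ?x) ?x
        = g' r * (- (p \<bullet> ?P b) / sin r)\<^sup>2
          + g r * ((norm (?P b))\<^sup>2 * cos r / sin r - (p \<bullet> ?P b)\<^sup>2 * cos r / sin r ^ 3)" for b
    proof -
      have tend: "((\<lambda>t. p \<bullet> great_circle ?x (?P b) t) \<longlongrightarrow> p \<bullet> ?x) (nhds 0)"
      proof -
        have "isCont (\<lambda>t. p \<bullet> great_circle ?x (?P b) t) 0"
          by (intro continuous_intros isCont_great_circle)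
        then show ?thesis
          using tendsto_at_iff_tendsto_nhds[of "\<lambda>t. p \<bullet> great_circle ?x (?P b) t" 0]
          by (simp add: isCont_def)
      qed
      have "cos \<delta> < cos r" using r \<delta> by (intro cos_monotone_0_pi) auto
      then have "cos \<delta> < p \<bullet> ?x" by (simp add: p\<gamma>)
      from order_tendstoD(1)[OF tend this]
      have "\<forall>\<^sub>F t in nhds 0. f (arccos (p \<bullet> great_circle ?x (?P b) t)) = u (great_circle ?x (?P b) t)"
        by eventually_elim
           (simp add: uf ball_iff norm_great_circle[OF n\<gamma> tangent_proj_orthogonal[OF n\<gamma>]])
      moreover have "jet2 f (arccos (p \<bullet> great_circle ?x (?P b) 0)) (g r) (g' r)"
        using jf[OF rS] r' by (simp add: p\<gamma> arccos_cos)
      note jet2_compose[OF this jet2_polar_angle[OF p n\<gamma> r' p\<gamma>]]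
      ultimately have "jet2 (\<lambda>t. u (great_circle ?x (?P b) t)) 0 (g r * (- (p \<bullet> ?P b) / sin r))
         (g' r * (- (p \<bullet> ?P b) / sin r)\<^sup>2
          + g r * ((norm (?P b))\<^sup>2 * cos r / sin r - (p \<bullet> ?P b)\<^sup>2 * cos r / sin r ^ 3))"
        by (rule jet2_cong[rotated])
      from jet2_unique(2)[OF jet2_smooth_great_circle[OF U(3,1) xU] this] show ?thesis .
    qed
    have "- m * f r = sphere_laplacian u ?x" using eigen[OF xB] by (simp add: f_def)
    also have "\<dots> = g' r + (real DIM('a) - 2) * (cos r / sin r) * g r"
      unfolding sphere_laplacian_eq[OF U(3,1) xU n\<gamma>] eq by (rule sum_radial_jet2[OF p n\<gamma> r' p\<gamma>])
    finally have "g' r = - m * f r - (real k + 1) * (cos r / sin r) * g r"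
      using dim by simp
    then show ?thesis unfolding mult_minus_left by linarith
  qed
  have "g \<delta> = 0"
  proof -
    have "(cos \<delta>)\<^sup>2 = 1 - (sin \<delta>)\<^sup>2" by (rule cos_squared_eq)
    then have "(1 / sin \<delta>) *\<^sub>R (p - cos \<delta> *\<^sub>R \<gamma> \<delta>) = - \<gamma>' \<delta>"
      using sin_cos_pos(1)
      by (simp add: \<gamma>_eq \<gamma>'_def scaleR_add_right scaleR_diff_right power2_eq_square
          flip: scaleR_diff_left diff_divide_distrib)
    with normal_derivative[OF n\<gamma> p\<gamma>]
    have "frechet_derivative u (at (\<gamma> \<delta>)) (- \<gamma>' \<delta>) = 0" by simp
    moreover have "\<gamma> \<delta> \<in> U" using S[of \<delta>] \<delta> by (simp add: S_def)
    ultimately show ?thesis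
      using linear_neg[OF smooth_on_linear(1)[OF U(3,1)], of "\<gamma> \<delta>" "\<gamma>' \<delta>"] by (simp add: g_def)
  qed
  moreover have "g 0 = 0"
  proof -
    have 0: "0 \<in> S" using S[of 0] \<delta> by simp
    \<comment> \<open>Times r and - r lie at the same distance from the pole, so f is even and its
      derivative at 0 vanishes.\<close>
    have "f (- r) = f r" if "r \<in> {-\<delta><..<\<delta>}" for r
      unfolding f_def using that by (intro rad \<gamma>_ball) (auto simp: p\<gamma>)
    then have ev: "\<forall>\<^sub>F r in nhds 0. f (- r) = f r"
      using \<delta> eventually_nhds_in_open[of "{-\<delta><..<\<delta>}" 0] by (auto elim: eventually_mono)
    have "((\<lambda>r. f (- r)) has_real_derivative g 0 * - 1) (at 0)"
      by (rule DERIV_chain2[where f=f and g=uminus])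
         (use Df[OF 0] in \<open>auto intro!: derivative_eq_intros\<close>)
    then have "(f has_real_derivative g 0 * - 1) (at 0)"
      by (rule iffD1[OF DERIV_cong_ev[OF refl ev refl]])
    from DERIV_unique[OF this Df[OF 0]] show ?thesis by simp
  qed
  ultimately show ?thesis
  proof (intro that[of f g])
    fix r assume "r \<in> {0<..<\<delta>}"
    then show "(g has_real_derivative - (real k + 1) * (cos r / sin r) * g r - m * f r) (at r)"
      using Dg[of r] S[of r] ode[of r] by simp
  qed (auto intro!: uf Df S DERIV_isCont[OF Dg])
qed

text \<open>Picone's identity for g = f' against sin r H(r), whose logarithmic derivative is cot r -
  y. The resulting E is nondecreasing and vanishes at both ends, so it is constant; its derivative
  dominates a positive multiple of g^2 in the interior, which gives g = 0.\<close>

lemma radial_part_vanishes: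
  assumes rad: "\<And>x y. x \<in> geodesic_ball p \<delta> \<Longrightarrow> y \<in> geodesic_ball p \<delta> \<Longrightarrow> p \<bullet> x = p \<bullet> y \<Longrightarrow> u x = u y"
    and x: "x \<in> geodesic_ball p \<delta>"
  shows "u x = 0"
proof -
  obtain f g where uf: "\<And>x. x \<in> geodesic_ball p \<delta> \<Longrightarrow> u x = f (arccos (p \<bullet> x))"
    and Df: "\<And>r. r \<in> {0..\<delta>} \<Longrightarrow> (f has_real_derivative g r) (at r)"
    and cg: "\<And>r. r \<in> {0..\<delta>} \<Longrightarrow> isCont g r"
    and Dg: "\<And>r. r \<in> {0<..<\<delta>} \<Longrightarrow> (g has_real_derivative - (real k + 1) * (cos r / sin r) * g r - m * f r) (at r)"
    and g0: "g 0 = 0" "g \<delta> = 0"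
    by (rule radial_ode) (erule (2) rad, (rule that; assumption))
  define l where "l = sin \<delta> ^ k * cos \<delta> / sin_int k \<delta>"
  obtain L \<kappa> where L: "0 < \<kappa>" "0 < L" "barrier k L \<delta> < cos \<delta> / sin \<delta>"
    "\<And>r. 0 < r \<Longrightarrow> r \<le> \<delta> \<Longrightarrow>
       l + \<kappa> \<le> L + barrier k L r * (2 * (cos r / sin r) - barrier k L r)"
    by (rule barrier_bounds[OF \<delta> l_def]) (rule that; assumption)
  \<comment> \<open>On the open interval this is \<open>sin r ^ (k + 1) (g g' - g\<^sup>2 q)\<close> with \<open>q = cot r - y\<close>; the
    Riccati inequality for \<open>q\<close> makes it monotone.\<close>
  define E where "E r = L * sin_int k r * (g r)\<^sup>2 - (real k + 2) * sin r ^ k * cos r * (g r)\<^sup>2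
     - m * sin r ^ (k + 1) * g r * f r" for r
  define Q where "Q r = (- (real k + 1) * (cos r / sin r) * g r - m * f r - g r * (cos r / sin r - barrier k L r))\<^sup>2
     + (g r)\<^sup>2 * (L + barrier k L r * (2 * (cos r / sin r) - barrier k L r) + real k + 2 - m)" for r
  have DE: "(E has_real_derivative sin r ^ (k + 1) * Q r) (at r)" if r: "r \<in> {0<..<\<delta>}" for r
  proof -
    have r': "0 < r" "r < pi / 2" using r \<delta> by auto
    have s: "0 < sin r" using r' by (intro sin_gt_zero) auto
    define c where "c = cos r / sin r"
    define y where "y = barrier k L r"
    define G where "G = - (real k + 1) * c * g r - m * f r"
    have rr: "r \<in> {0..\<delta>}" using r by simp
    note DgG = Dg[OF r, folded c_def, folded G_def]
    note Dy = barrier_has_derivative[OF r', of k L, folded c_def y_def]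
    have Dc: "((\<lambda>r. cos r / sin r) has_real_derivative - 1 - c\<^sup>2) (at r)"
      using s by (auto intro!: derivative_eq_intros simp: c_def power2_eq_square field_simps)
    \<comment> \<open>K is E divided by \<open>sin r ^ (k + 1)\<close>, with g' already eliminated
      through the equation, so no second derivative of g arises.\<close>
    define K where "K r = barrier k L r * (g r)\<^sup>2 - (real k + 2) * (cos r / sin r) * (g r)\<^sup>2 - m * g r * f r" for r
    have "(K has_real_derivative
        (L - (real k + 1) * c * y) * (g r)\<^sup>2 + y * (2 * g r * G)
        - ((real k + 2) * (- 1 - c\<^sup>2) * (g r)\<^sup>2 + (real k + 2) * c * (2 * g r * G))
        - (m * G * f r + m * g r * g r)) (at r)"
      unfolding K_def
      by (rule derivative_eq_intros DgG Dy Dc Df[OF rr] refl)+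
         (simp add: c_def y_def power2_eq_square algebra_simps)
    from DERIV_mult[OF sin_power_has_derivative[of k r] this]
    have "((\<lambda>r. sin r ^ (k + 1) * K r) has_real_derivative
        (real k + 1) * sin r ^ k * cos r * K r + ((L - (real k + 1) * c * y) * (g r)\<^sup>2 + y * (2 * g r * G)
        - ((real k + 2) * (- 1 - c\<^sup>2) * (g r)\<^sup>2 + (real k + 2) * c * (2 * g r * G))
        - (m * G * f r + m * g r * g r)) * sin r ^ (k + 1)) (at r)" .
    also have "sin r ^ k * cos r = sin r ^ (k + 1) * c" using s by (simp add: c_def)
    then have "(real k + 1) * sin r ^ k * cos r * K r = sin r ^ (k + 1) * ((real k + 1) * c * K r)"
      by (simp add: mult_ac)
    also have "K r = y * (g r)\<^sup>2 - (real k + 2) * c * (g r)\<^sup>2 - m * g r * f r"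
      by (simp add: K_def c_def y_def)
    also have "sin r ^ (k + 1) * ((real k + 1) * c * (y * (g r)\<^sup>2 - (real k + 2) * c * (g r)\<^sup>2 - m * g r * f r))
       + ((L - (real k + 1) * c * y) * (g r)\<^sup>2 + y * (2 * g r * G)
        - ((real k + 2) * (- 1 - c\<^sup>2) * (g r)\<^sup>2 + (real k + 2) * c * (2 * g r * G))
        - (m * G * f r + m * g r * g r)) * sin r ^ (k + 1)
      = sin r ^ (k + 1) * ((G - g r * (c - y))\<^sup>2 + (g r)\<^sup>2 * (L + y * (2 * c - y) + real k + 2 - m))"
      unfolding G_def by (simp add: power2_eq_square algebra_simps)
    also have "(G - g r * (c - y))\<^sup>2 + (g r)\<^sup>2 * (L + y * (2 * c - y) + real k + 2 - m) = Q r"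
      by (simp add: Q_def G_def c_def y_def)
    finally have D: "((\<lambda>r. sin r ^ (k + 1) * K r) has_real_derivative sin r ^ (k + 1) * Q r) (at r)" .
    have "E s = sin s ^ (k + 1) * K s" if "s \<in> {0<..<\<delta>}" for s
    proof -
      have "0 < sin s" using that \<delta> by (intro sin_gt_zero) auto
      then show ?thesis by (simp add: E_def K_def barrier_def field_simps)
    qed
    then have "\<forall>\<^sub>F s in nhds r. sin s ^ (k + 1) * K s = E s"
      using eventually_nhds_in_open[of "{0<..<\<delta>}" r] r by (auto elim!: eventually_mono)
    then show ?thesis using D by (rule iffD1[OF DERIV_cong_ev[OF refl _ refl]])
  qed
  have Qlow: "\<kappa> * (g r)\<^sup>2 \<le> Q r" if "r \<in> {0<..<\<delta>}" for r
  proof -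
    have "\<kappa> \<le> L + barrier k L r * (2 * (cos r / sin r) - barrier k L r) + real k + 2 - m"
      using L(4)[of r] that m_le by (simp add: l_def)
    from mult_right_mono[OF this, of "(g r)\<^sup>2"] show ?thesis
      unfolding Q_def by (simp add: mult.commute add_increasing)
  qed
  have sp: "0 < sin r" if "r \<in> {0<..<\<delta>}" for r
    using that \<delta> by (intro sin_gt_zero) auto
  have Enn: "0 \<le> sin r ^ (k + 1) * Q r" if "r \<in> {0<..<\<delta>}" for r
  proof -
    have "0 \<le> \<kappa> * (g r)\<^sup>2" using L(1) by simp
    also note Qlow[OF that]
    finally show ?thesis using sp[OF that] by simp
  qed
  have cont: "continuous_on {0..\<delta>} f" "continuous_on {0..\<delta>} g"
    using cg by (auto intro!: continuous_at_imp_continuous_on DERIV_isCont[OF Df])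
  have contE: "continuous_on {0..\<delta>} E"
    unfolding E_def by (intro continuous_intros cont continuous_on_sin_int)
  have mono: "E a \<le> E b" if "0 \<le> a" "a \<le> b" "b \<le> \<delta>" for a b
  proof (rule DERIV_nonneg_imp_increasing_open[OF that(2)])
    show "continuous_on {a..b} E" using contE by (rule continuous_on_subset) (use that in auto)
    fix r assume "a < r" "r < b"
    then have r: "r \<in> {0<..<\<delta>}" using that by auto
    then show "\<exists>y. (E has_real_derivative y) (at r) \<and> 0 \<le> y" using DE[OF r] Enn[OF r] by blast
  qed
  have E0: "E 0 = 0" "E \<delta> = 0" by (simp_all add: E_def g0)
  have "E r = 0" if "r \<in> {0<..<\<delta>}" for r
    using mono[of 0 r] mono[of r \<delta>] E0 that by simp
  then have Q0: "sin r ^ (k + 1) * Q r = 0" if "r \<in> {0<..<\<delta>}" for r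
    by (intro DERIV_eq_0_if_locally_const[OF DE[OF that] _ that]) auto
  have gz: "g r = 0" if "r \<in> {0<..<\<delta>}" for r
  proof -
    have "Q r = 0" using Q0[OF that] sp[OF that] by simp
    then show ?thesis using Qlow[OF that] L(1) by (simp add: mult_le_0_iff)
  qed
  have fz: "f r = 0" if "r \<in> {0<..<\<delta>}" for r
  proof -
    \<comment> \<open>With g = 0 on the interval, the equation for its derivative leaves only m f =
      0.\<close>
    have "- (real k + 1) * (cos r / sin r) * g r - m * f r = 0"
      by (rule DERIV_eq_0_if_locally_const[OF Dg[OF that] _ that gz]) auto
    then show ?thesis using gz[OF that] m by simp
  qed
  have cl: "closure {0<..<\<delta>} = {0..\<delta>}" using \<delta> by simp
  have nx: "norm x = 1" using x by (simp add: ball_iff)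
  have "arccos (p \<bullet> x) \<in> {0..\<delta>}"
    using x inner_bounds_unit[OF p nx] by (auto simp: geodesic_ball_def intro: arccos_lbound)
  then have "f (arccos (p \<bullet> x)) = 0"
    using continuous_constant_on_closure[of "{0<..<\<delta>}" f 0] cont(1) fz unfolding cl by blast
  then show ?thesis using uf[OF x] by simp
qed

text \<open>Points at equal distance from p are swapped by a reflection fixing p. Comparing in both
  directions gives equal values there, so u is radial.\<close>

lemma eigenfunction_vanishes:
  assumes "x \<in> geodesic_ball p \<delta>"
  shows "u x = 0"
proof (rule radial_part_vanishes[OF _ assms])
  fix x y assume x: "x \<in> geodesic_ball p \<delta>" and y: "y \<in> geodesic_ball p \<delta>" and xy: "p \<bullet> x = p \<bullet> y"
  have le: "u y \<le> u x" if x: "x \<in> geodesic_ball p \<delta>" and y: "y \<in> geodesic_ball p \<delta>"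
    and xy: "p \<bullet> x = p \<bullet> y" for x y
  proof (cases "x = y")
    case False
    have n: "norm x = norm y" using x y by (simp add: ball_iff)
    define e where "e = (1 / norm (y - x)) *\<^sub>R (y - x)"
    have "norm e = 1" "e \<bullet> p = 0" using False xy by (auto simp: e_def inner_diff_right inner_commute[of _ p])
    moreover have "0 \<le> e \<bullet> y"
    proof -
      have "x \<bullet> y \<le> norm y * norm y" using norm_cauchy_schwarz[of x y] n by simp
      then show ?thesis
        by (simp add: e_def inner_diff_left dot_square_norm power2_eq_square)
    qed
    ultimately have "u y \<le> u (reflect e y)" using y by (intro half_ball_comparison)
    also have "reflect e y = x" unfolding e_def using n False by (intro reflect_swap) auto
    finally show ?thesis .
  qed simp
  show "u x = u y" using le[OF x y xy] le[OF y x xy[symmetric]] by simp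
qed

end

theorem neumann_eigenvalue_gt_mu_tilde:
  fixes p :: "'a::euclidean_space"
  assumes "n \<ge> 2" "DIM('a) = n + 1" "norm p = 1" "0 < \<delta>" "\<delta> < pi / 2" "0 < m"
    and "neumann_eigenvalue p \<delta> m"
  shows "mu_tilde n \<delta> < m"
proof (rule ccontr)
  assume "\<not> mu_tilde n \<delta> < m"
  define k where "k = n - 2"
  have n: "n = k + 2" using assms(1) by (simp add: k_def)
  from assms(7) obtain u U where u: "open U" "geodesic_ball p \<delta> \<subseteq> U" "smooth_on u U"
    "\<exists>x\<in>geodesic_ball p \<delta>. u x \<noteq> 0"
    "\<And>x. x \<in> geodesic_ball p \<delta> \<Longrightarrow> - sphere_laplacian u x = m * u x"
    "\<And>x. x \<in> geodesic_sphere p \<delta> \<Longrightarrow> sphere_grad u x \<bullet> outward_normal p \<delta> x = 0"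
    unfolding neumann_eigenvalue_def by blast
  have "m \<le> real k + 2 + sin \<delta> ^ k * cos \<delta> / sin_int k \<delta>"
    using \<open>\<not> _\<close> by (simp add: mu_tilde_def n sin_int_def)
  then interpret neumann_ball p k \<delta> m u U
    using assms n u by unfold_locales auto
  show False using eigenfunction_vanishes u(4) by blast
qed

section \<open>The zeros of the equations\<close>

lemma mu_tilde_eq: "mu_tilde (k + 2) \<delta> = real k + 2 + sin \<delta> ^ k * cos \<delta> / sin_int k \<delta>"
  by (simp add: mu_tilde_def sin_int_def)

text \<open>The bracket shared by \<open>F\<close> and \<open>F_tilde\<close>, with the eigenvalue
  \<open>M\<close> and x = cos \<delta> as separate variables so that monotonicity in each can be
  used.\<close>

definition denom :: "real \<Rightarrow> real \<Rightarrow> real \<Rightarrow> real" where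
  "denom n M x = 1 - (1 - n / (2 * M)) * x"

lemma denom_pos:
  assumes "0 < n" "n \<le> M" "0 \<le> x" "x \<le> 1"
  shows "0 < denom n M x"
proof -
  have "0 < n / (2 * M)" "n / (2 * M) \<le> 1" using assms by (auto simp: divide_simps)
  then have "(1 - n / (2 * M)) * x \<le> (1 - n / (2 * M)) * 1" using assms by (intro mult_left_mono) auto
  also have "\<dots> < 1" using \<open>0 < n / (2 * M)\<close> by simp
  finally show ?thesis by (simp add: denom_def)
qed

lemma denom_strict_antimono:
  assumes "0 < n" "n \<le> M" "M < M'" "0 < x"
  shows "denom n M' x < denom n M x"
  using assms by (simp add: denom_def frac_less2 mult_strict_right_mono)

text \<open>A smaller radius increases both cos and \<open>mu_tilde\<close>, and both changes push
  the bracket down.\<close>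

lemma denom_antimono:
  assumes "0 < n" "n \<le> M" "M \<le> M'" "0 \<le> x" "x < x'"
  shows "denom n M' x' < denom n M x"
proof -
  have le: "n / (2 * M') \<le> n / (2 * M)" using assms by (intro divide_left_mono) auto
  have half: "n / (2 * M) \<le> 1 / 2" using assms by (auto simp: divide_simps)
  have "(1 - n / (2 * M)) * x < (1 - n / (2 * M)) * x'"
    using half assms by (intro mult_strict_left_mono) auto
  also have "\<dots> \<le> (1 - n / (2 * M')) * x'"
    using le assms by (intro mult_right_mono) auto
  finally show ?thesis by (simp add: denom_def)
qed

text \<open>Since n / sin^2 \<delta> = n + n cot^2 \<delta>, the first bound is
  \<open>sin_int_upper\<close> multiplied by cos \<delta>.\<close>

lemma mu_tilde_bounds:
  assumes "0 < \<delta>" "\<delta> < pi / 2"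
  shows "(real k + 2) / (1 - (cos \<delta>)\<^sup>2) \<le> mu_tilde (k + 2) \<delta>" "real k + 2 < mu_tilde (k + 2) \<delta>"
proof -
  have c: "0 < cos \<delta>" and s: "0 < sin \<delta>" using assms by (auto intro!: cos_gt_zero_pi sin_gt_zero)
  have I: "0 < sin_int k \<delta>" using assms by (intro sin_int_pos) auto
  show "real k + 2 < mu_tilde (k + 2) \<delta>" unfolding mu_tilde_eq using c s I by simp
  have "cos \<delta> * ((real k + 2) * (cos \<delta> * sin_int k \<delta>)) \<le> cos \<delta> * sin \<delta> ^ (k + 2)"
    using c assms by (intro mult_left_mono sin_int_upper) auto
  then have "(real k + 2) * (cos \<delta>)\<^sup>2 / (sin \<delta>)\<^sup>2 \<le> sin \<delta> ^ k * cos \<delta> / sin_int k \<delta>"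
    using s I by (simp add: divide_simps power2_eq_square mult_ac)
  moreover have "(real k + 2) / (1 - (cos \<delta>)\<^sup>2) = real k + 2 + (real k + 2) * (cos \<delta>)\<^sup>2 / (sin \<delta>)\<^sup>2"
    using s by (simp add: sin_squared_eq[symmetric] field_simps)
       (simp add: cos_squared_eq algebra_simps)
  ultimately show "(real k + 2) / (1 - (cos \<delta>)\<^sup>2) \<le> mu_tilde (k + 2) \<delta>"
    unfolding mu_tilde_eq by simp
qed

text \<open>The excess of \<open>mu_tilde\<close> over n is the reciprocal of the increasing
  quantity in \<open>cot_ratio_strict_mono\<close>.\<close>

lemma mu_tilde_antimono:
  assumes "0 < a" "a < b" "b < pi / 2"
  shows "mu_tilde (k + 2) b \<le> mu_tilde (k + 2) a"
proof -
  have eq: "sin r ^ k * cos r / sin_int k r = 1 / (barrier k 1 r * (sin r / cos r))"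
    and pos: "0 < barrier k 1 r * (sin r / cos r)" if "0 < r" "r < pi / 2" for r
  proof -
    have "0 < cos r" "0 < sin r" using that by (auto intro!: cos_gt_zero_pi sin_gt_zero)
    moreover have "0 < sin_int k r" using that by (intro sin_int_pos) auto
    ultimately show "sin r ^ k * cos r / sin_int k r = 1 / (barrier k 1 r * (sin r / cos r))"
      "0 < barrier k 1 r * (sin r / cos r)"
      by (auto simp: barrier_def)
  qed
  show ?thesis unfolding mu_tilde_eq
    using eq[of a] eq[of b] pos[of a] pos[of b] cot_ratio_strict_mono[OF assms, of k] assms
    by (simp add: frac_le del: times_divide_eq_right)
qed

lemma F_tilde_eq:
  "F_tilde n \<delta> = (real n + 1) / (8 * real n) * inverse (denom (real n) (mu_tilde n \<delta>) (cos \<delta>))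
     + ((real n + 3) * (cos \<delta>)\<^sup>2 - 4) / (4 * (1 - (cos \<delta>)\<^sup>2))"
  by (simp add: F_tilde_def denom_def mult.commute)

lemma F_eq:
  "F n \<mu> \<delta> = (real n + 1) / (8 * real n) * inverse (denom (real n) (\<mu> \<delta>) (cos \<delta>))
     + ((real n + 3) * (cos \<delta>)\<^sup>2 - 4) / (4 * (1 - (cos \<delta>)\<^sup>2))"
  by (simp add: F_def denom_def sin_squared_eq)

text \<open>The term equals (n - 1) / (4 (1 - x^2)) - (n + 3) / 4.\<close>

lemma rational_term_mono:
  assumes "1 < n" "0 \<le> x" "x < x'" "x' < (1::real)"
  shows "((n + 3) * x\<^sup>2 - 4) / (4 * (1 - x\<^sup>2)) < ((n + 3) * x'\<^sup>2 - 4) / (4 * (1 - x'\<^sup>2))"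
proof -
  have eq: "((n + 3) * x\<^sup>2 - 4) / (4 * (1 - x\<^sup>2)) = (n - 1) / (4 * (1 - x\<^sup>2)) - (n + 3) / 4"
    if "0 \<le> x" "x < 1" for x
  proof -
    have "x\<^sup>2 < 1" using that by (simp add: abs_square_less_1)
    then show ?thesis by (simp add: field_simps)
  qed
  have 1: "x\<^sup>2 < x'\<^sup>2" using assms by (intro power_strict_mono) auto
  have 2: "x'\<^sup>2 < 1" using assms by (simp add: abs_square_less_1)
  have "(n - 1) / (4 * (1 - x\<^sup>2)) < (n - 1) / (4 * (1 - x'\<^sup>2))"
    using assms 1 2 by (intro divide_strict_left_mono mult_pos_pos) auto
  then show ?thesis using eq[of x] eq[of x'] assms by simp
qed

lemma F_tilde_strict_antimono:
  assumes "n \<ge> 2" "0 < a" "a < b" "b < pi / 2"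
  shows "F_tilde n b < F_tilde n a"
proof -
  obtain k where n: "n = k + 2" using assms(1) by (metis le_add_diff_inverse2)
  have c: "0 < cos b" "cos b < cos a" "cos a < 1"
    using assms cos_monotone_0_pi[of a b] cos_monotone_0_pi[of 0 a] by (auto intro!: cos_gt_zero_pi)
  have mu: "real n < mu_tilde n b" "mu_tilde n b \<le> mu_tilde n a"
    using mu_tilde_bounds(2)[of b k] mu_tilde_antimono[of a b k] assms by (auto simp: n)
  have "denom (real n) (mu_tilde n a) (cos a) < denom (real n) (mu_tilde n b) (cos b)"
    using mu c assms by (intro denom_antimono) auto
  moreover have "0 < denom (real n) (mu_tilde n a) (cos a)"
    using mu c assms by (intro denom_pos) auto
  ultimately have "inverse (denom (real n) (mu_tilde n b) (cos b))
      < inverse (denom (real n) (mu_tilde n a) (cos a))"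
    by (intro less_imp_inverse_less)
  then have "(real n + 1) / (8 * real n) * inverse (denom (real n) (mu_tilde n b) (cos b))
      < (real n + 1) / (8 * real n) * inverse (denom (real n) (mu_tilde n a) (cos a))"
    using assms(1) by (intro mult_strict_left_mono) auto
  moreover have "((real n + 3) * (cos b)\<^sup>2 - 4) / (4 * (1 - (cos b)\<^sup>2))
      < ((real n + 3) * (cos a)\<^sup>2 - 4) / (4 * (1 - (cos a)\<^sup>2))"
    using c assms(1) by (intro rational_term_mono) auto
  ultimately show ?thesis unfolding F_tilde_eq by (rule add_strict_mono)
qed

lemma F_tilde_zero_exists:
  assumes "n \<ge> 2"
  obtains \<delta> where "0 < \<delta>" "\<delta> < pi / 2" "F_tilde n \<delta> = 0"
proof -
  obtain k where n: "n = k + 2" using assms by (metis le_add_diff_inverse2)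
  \<comment> \<open>At a the rational term vanishes, so \<open>F_tilde\<close> is positive; at pi /
    2 the bracket is 1 and the value is (n + 1) / (8 n) - 1 < 0.\<close>
  define a where "a = arccos (sqrt (4 / (real n + 3)))"
  have t: "0 < sqrt (4 / (real n + 3))" "sqrt (4 / (real n + 3)) < 1" using assms by auto
  then have ca: "cos a = sqrt (4 / (real n + 3))"
    unfolding a_def by (intro cos_arccos) linarith+
  from t have a: "0 < a" "a < pi / 2"
    using arccos_less_mono[of 1 "sqrt (4 / (real n + 3))"] arccos_less_mono[of "sqrt (4 / (real n + 3))" 0]
    by (auto simp: a_def)
  have cont: "continuous_on {a..pi / 2} (F_tilde n)"
  proof -
    have ne: "denom (real n) (mu_tilde n x) (cos x) \<noteq> 0" "mu_tilde n x \<noteq> 0" "sin_int k x \<noteq> 0"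
      "1 - (cos x)\<^sup>2 \<noteq> 0" if x: "x \<in> {a..pi / 2}" for x
    proof -
      have c: "0 \<le> cos x" and s: "0 < sin x"
        using x a by (auto intro!: cos_ge_zero sin_gt_zero)
      have I: "0 < sin_int k x" using x a by (intro sin_int_pos) auto
      have mu: "real n \<le> mu_tilde n x" unfolding n mu_tilde_eq using c s I by simp
      show "sin_int k x \<noteq> 0" using I by simp
      show "mu_tilde n x \<noteq> 0" using mu assms by simp
      show "denom (real n) (mu_tilde n x) (cos x) \<noteq> 0"
        using denom_pos[of "real n" "mu_tilde n x" "cos x"] mu c assms by simp
      show "1 - (cos x)\<^sup>2 \<noteq> 0" using s by (simp add: sin_squared_eq[symmetric])
    qed
    have "continuous_on {a..pi / 2} (sin_int k)"
      using continuous_on_sin_int[of "pi / 2" k] by (rule continuous_on_subset) (use a in auto)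
    then have cmu: "continuous_on {a..pi / 2} (mu_tilde n)"
      unfolding n mu_tilde_eq using ne(3) by (intro continuous_intros) auto
    then have "continuous_on {a..pi / 2} (\<lambda>x. denom (real n) (mu_tilde n x) (cos x))"
      unfolding denom_def using ne(2) by (intro continuous_intros) auto
    then show ?thesis
      unfolding F_tilde_eq using ne by (intro continuous_intros) auto
  qed
  have Fa: "0 < F_tilde n a"
  proof -
    have "real n < mu_tilde n a" using mu_tilde_bounds(2)[OF a, of k] by (simp add: n)
    then have "0 < denom (real n) (mu_tilde n a) (cos a)"
      using assms a by (intro denom_pos cos_ge_zero) auto
    moreover have "(real n + 3) * (cos a)\<^sup>2 = 4"
      unfolding ca using assms by (simp add: divide_simps)
    ultimately show ?thesis unfolding F_tilde_eq using assms by simp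
  qed
  have Fb: "F_tilde n (pi / 2) < 0"
    using assms by (simp add: F_tilde_eq denom_def field_simps)
  obtain \<delta> where \<delta>: "a \<le> \<delta>" "\<delta> \<le> pi / 2" "F_tilde n \<delta> = 0"
    using IVT2'[of "F_tilde n" "pi / 2" 0 a] Fa Fb cont a by auto
  moreover have "\<delta> \<noteq> pi / 2" using Fb \<delta>(3) by (metis less_irrefl)
  ultimately show ?thesis using a by (intro that[of \<delta>]) auto
qed

section \<open>The quartic in x = cos \<delta>\<close>

definition quartic :: "real \<Rightarrow> real \<Rightarrow> real" where
  "quartic n x = n * (n + 3) * x ^ 4 + n * (n + 3) * x ^ 3
     + 2 * n * (n + 1) * x\<^sup>2 + (1 - 3 * n) * x - 7 * n + 1"

text \<open>After division by \<open>x\<close>, every term of the quartic is nondecreasing in \<open>x\<close>.\<close>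

lemma quartic_sign_change:
  assumes "1 \<le> n" "0 < x" "x < y" "0 \<le> quartic n x"
  shows "0 < quartic n y"
proof -
  define R where "R x = n * (n + 3) * x ^ 3 + n * (n + 3) * x\<^sup>2 + 2 * n * (n + 1) * x + (1 - 3 * n)
      - (7 * n - 1) / x" for x
  have R: "quartic n x = x * R x" if "0 < x" for x
    using that by (simp add: R_def quartic_def field_simps power2_eq_square power3_eq_cube power4_eq_xxxx)
  have "0 \<le> R x" using assms(4) R[OF assms(2)] assms(2) by (simp add: zero_le_mult_iff)
  also have "R x < R y"
  proof -
    have "x ^ 3 \<le> y ^ 3" "x\<^sup>2 \<le> y\<^sup>2" using assms by (auto intro!: power_mono)
    then have "n * (n + 3) * x ^ 3 \<le> n * (n + 3) * y ^ 3" "n * (n + 3) * x\<^sup>2 \<le> n * (n + 3) * y\<^sup>2"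
      using assms by (auto intro!: mult_left_mono)
    moreover have "2 * n * (n + 1) * x < 2 * n * (n + 1) * y"
      using assms by (intro mult_strict_left_mono) auto
    moreover have "(7 * n - 1) / y \<le> (7 * n - 1) / x"
      using assms by (intro divide_left_mono) auto
    ultimately show ?thesis unfolding R_def by linarith
  qed
  finally show ?thesis using R[of y] assms by simp
qed

text \<open>The signs at 0 and 1 differ, and \<open>quartic_sign_change\<close> allows only one
  change. The second conclusion converts negativity at \<open>cos \<delta>\<^sub>0\<close> into the
  bound by the root.\<close>

lemma quartic_zero:
  assumes "1 \<le> n"
  obtains \<kappa> where "{x \<in> {0<..<1}. quartic n x = 0} = {\<kappa>}" "\<And>x. 0 < x \<Longrightarrow> x < 1 \<Longrightarrow> quartic n x < 0 \<Longrightarrow> x < \<kappa>"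
proof -
  have 0: "quartic n 0 < 0" using assms by (simp add: quartic_def)
  have "quartic n 1 = 4 * n * (n - 1) + 2 * n + 2" by (simp add: quartic_def algebra_simps)
  then have 1: "0 < quartic n 1" using assms by (simp add: add_nonneg_pos)
  have "continuous_on {0..1} (quartic n)" unfolding quartic_def by (intro continuous_intros)
  then obtain \<kappa> where \<kappa>: "0 \<le> \<kappa>" "\<kappa> \<le> 1" "quartic n \<kappa> = 0"
    using IVT'[of "quartic n" 0 0 1] 0 1 by auto
  have \<kappa>': "0 < \<kappa>" "\<kappa> < 1" using \<kappa> 0 1 by (auto simp: less_le)
  have "{x \<in> {0<..<1}. quartic n x = 0} = {\<kappa>}"
  proof (intro equalityI subsetI)
    fix x assume "x \<in> {x \<in> {0<..<1}. quartic n x = 0}"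
    then have x: "0 < x" "quartic n x = 0" by auto
    then show "x \<in> {\<kappa>}"
      using quartic_sign_change[OF assms, of x \<kappa>] quartic_sign_change[OF assms, of \<kappa> x] \<kappa> \<kappa>'
      by (cases x \<kappa> rule: linorder_cases) auto
  qed (use \<kappa> \<kappa>' in auto)
  moreover have "x < \<kappa>" if "0 < x" "x < 1" "quartic n x < 0" for x
    using quartic_sign_change[OF assms, of \<kappa> x] \<kappa> \<kappa>' that
    by (cases x \<kappa> rule: linorder_cases) auto
  ultimately show ?thesis by (intro that[of \<kappa>])
qed

text \<open>Equating the two terms to zero is the equation F = 0 cleared of denominators when the
  eigenvalue is n / (1 - x^2).\<close>

lemma quartic_factored:
  "quartic n x = (n + 1) * (1 + x) - n * (4 - (n + 3) * x\<^sup>2) * (2 + x + x\<^sup>2)"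
  by (simp add: quartic_def power2_eq_square power3_eq_cube power4_eq_xxxx algebra_simps)

text \<open>
  The bound \<open>n / (1 - x\<^sup>2)\<close> for the eigenvalue turns \<^const>\<open>denom\<close> into
  \<open>(1 - x) (2 + x + x\<^sup>2) / 2\<close>.
\<close>

lemma quartic_neg:
  assumes n: "1 \<le> n" and x: "0 < x" "x < 1" and M: "n / (1 - x\<^sup>2) < M"
    and zero: "(n + 1) / (8 * n) * inverse (denom n M x) + ((n + 3) * x\<^sup>2 - 4) / (4 * (1 - x\<^sup>2)) = 0"
  shows "quartic n x < 0"
proof -
  have x2: "0 < 1 - x\<^sup>2" using x by (simp add: abs_square_less_1)
  have "n \<le> n / (1 - x\<^sup>2)" using n x2 by (simp add: field_simps)
  have "denom n M x < denom n (n / (1 - x\<^sup>2)) x"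
    using n x \<open>n \<le> _\<close> M by (intro denom_strict_antimono) auto
  also have "\<dots> = (1 - x) * (2 + x + x\<^sup>2) / 2"
    using n x2 by (simp add: denom_def field_simps power2_eq_square)
  finally have D: "denom n M x < (1 - x) * (2 + x + x\<^sup>2) / 2" .
  have D0: "0 < denom n M x" using n x M \<open>n \<le> _\<close> by (intro denom_pos) auto
  define A where "A = 4 - (n + 3) * x\<^sup>2"
  have "(n + 1) / (8 * n) * inverse (denom n M x) = - (((n + 3) * x\<^sup>2 - 4) / (4 * (1 - x\<^sup>2)))"
    using zero by (rule eq_neg_iff_add_eq_0[THEN iffD2])
  also have "\<dots> = A / (4 * (1 - x\<^sup>2))"
    unfolding minus_divide_left by (simp add: A_def)
  finally have "(n + 1) / (8 * n * denom n M x) = A / (4 * (1 - x\<^sup>2))"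
    unfolding divide_inverse inverse_mult_distrib by (simp only: mult.assoc)
  then have "(n + 1) * (4 * (1 - x\<^sup>2)) = A * (8 * n * denom n M x)"
    using n x2 D0 by (subst (asm) frac_eq_eq) auto
  then have eq: "(n + 1) * (1 - x\<^sup>2) = 2 * n * A * denom n M x"
    by (simp only: mult.assoc mult.left_commute[of _ 4] mult.left_commute[of _ 8]) simp
  \<comment> \<open>The sign of A is read off from the equation itself; it is needed to multiply the
    bound on \<open>denom\<close> by A.\<close>
  have "0 < (n + 1) * (1 - x\<^sup>2)" using n x2 by simp
  then have "0 < 2 * n * A" unfolding eq using D0 by (simp add: zero_less_mult_iff)
  then have "2 * n * A * denom n M x < 2 * n * A * ((1 - x) * (2 + x + x\<^sup>2) / 2)"
    using D by (intro mult_strict_left_mono)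
  then have "(1 - x) * ((n + 1) * (1 + x)) < (1 - x) * (n * A * (2 + x + x\<^sup>2))"
    unfolding eq[symmetric] by (simp add: power2_eq_square algebra_simps)
  then have "(n + 1) * (1 + x) < n * A * (2 + x + x\<^sup>2)"
    using x by (auto dest: mult_left_less_imp_less)
  then show ?thesis by (simp add: quartic_factored A_def)
qed

text \<open>From (1 - x) (2 + x + x^2) = 2 - x - x^3 <= 2, the factor 2 + x + x^2 can be cancelled
  in the factored inequality, which leaves one that is linear in x^2.\<close>

lemma quartic_neg_imp_square_less:
  assumes n: "1 \<le> n" and x: "0 < x" "x < 1" and neg: "quartic n x < 0"
  shows "x\<^sup>2 < (7 * n - 1) / (2 * n\<^sup>2 + 5 * n - 1)"
proof -
  define A where "A = n * (4 - (n + 3) * x\<^sup>2)"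
  have B: "0 < 2 + x + x\<^sup>2" using x by (simp add: add_pos_pos)
  have "(n + 1) * (1 + x) < A * (2 + x + x\<^sup>2)" using neg by (simp add: quartic_factored A_def)
  moreover have "(1 - x\<^sup>2) * (2 + x + x\<^sup>2) \<le> 2 * (1 + x)"
  proof -
    have "2 * (1 + x) - (1 - x\<^sup>2) * (2 + x + x\<^sup>2) = (1 + x) * (x + x ^ 3)"
      by (simp add: power2_eq_square power3_eq_cube algebra_simps)
    moreover have "0 \<le> (1 + x) * (x + x ^ 3)" using x by simp
    ultimately show ?thesis by linarith
  qed
  then have "(n + 1) * ((1 - x\<^sup>2) * (2 + x + x\<^sup>2)) \<le> (n + 1) * (2 * (1 + x))"
    using n by (intro mult_left_mono) auto
  moreover have "(n + 1) * (2 * (1 + x)) = 2 * ((n + 1) * (1 + x))" by simp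
  ultimately have "(n + 1) * ((1 - x\<^sup>2) * (2 + x + x\<^sup>2)) < 2 * (A * (2 + x + x\<^sup>2))" by linarith
  then have "((n + 1) * (1 - x\<^sup>2)) * (2 + x + x\<^sup>2) < (2 * A) * (2 + x + x\<^sup>2)"
    by (simp only: mult.assoc)
  then have "(n + 1) * (1 - x\<^sup>2) < 2 * A" using less_imp_le[OF B] by (rule mult_right_less_imp_less)
  moreover have "2 * A - (n + 1) * (1 - x\<^sup>2) = 7 * n - 1 - x\<^sup>2 * (2 * n\<^sup>2 + 5 * n - 1)"
    by (simp add: A_def power2_eq_square algebra_simps)
  ultimately have "x\<^sup>2 * (2 * n\<^sup>2 + 5 * n - 1) < 7 * n - 1" by linarith
  moreover have "0 < 2 * n\<^sup>2 + 5 * n - 1" using n zero_le_power2[of n] by linarith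
  ultimately show ?thesis by (simp add: pos_less_divide_eq)
qed

theorem proposition2p3:
  fixes n :: nat and p :: "'a::euclidean_space" and \<mu> :: "real \<Rightarrow> real" and \<delta>\<^sub>0 :: real
  assumes "n \<ge> 2" and "DIM('a) = n + 1" and "norm p = 1"
    and "\<And>\<delta>. 0 < \<delta> \<Longrightarrow> \<delta> \<le> pi / 2 \<Longrightarrow> is_first_neumann_eigenvalue p \<delta> (\<mu> \<delta>)"
    and "{\<delta> \<in> {0<..<pi / 2}. F n \<mu> \<delta> = 0} = {\<delta>\<^sub>0}"
  shows "(\<exists>\<delta>'. {\<delta> \<in> {0<..<pi / 2}. F_tilde n \<delta> = 0} = {\<delta>'} \<and> \<delta>\<^sub>0 > \<delta>') \<and>
    (\<exists>\<kappa>. {x \<in> {0<..<1}. real n * (real n + 3) * x ^ 4 + real n * (real n + 3) * x ^ 3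
              + 2 * real n * (real n + 1) * x\<^sup>2 + (1 - 3 * real n) * x - 7 * real n + 1 = 0} = {\<kappa>}
          \<and> cos \<delta>\<^sub>0 < \<kappa>) \<and>
    (cos \<delta>\<^sub>0)\<^sup>2 < (7 * real n - 1) / (2 * (real n)\<^sup>2 + 5 * real n - 1)"
proof (intro conjI)
  have n: "1 \<le> real n" "0 < real n" using \<open>n \<ge> 2\<close> by simp_all
  obtain k where k: "n = k + 2" using \<open>n \<ge> 2\<close> by (metis le_add_diff_inverse2)
  define x where "x = cos \<delta>\<^sub>0"
  have "\<delta>\<^sub>0 \<in> {\<delta> \<in> {0<..<pi / 2}. F n \<mu> \<delta> = 0}" using assms(5) by simp
  then have \<delta>\<^sub>0: "0 < \<delta>\<^sub>0" "\<delta>\<^sub>0 < pi / 2" "F n \<mu> \<delta>\<^sub>0 = 0" by auto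
  have x: "0 < x" "x < 1"
    using \<delta>\<^sub>0 cos_monotone_0_pi[of 0 \<delta>\<^sub>0] by (auto simp: x_def intro!: cos_gt_zero_pi)
  have "is_first_neumann_eigenvalue p \<delta>\<^sub>0 (\<mu> \<delta>\<^sub>0)" using \<delta>\<^sub>0 by (intro assms(4)) auto
  then have mu: "mu_tilde n \<delta>\<^sub>0 < \<mu> \<delta>\<^sub>0"
    using assms(1-3) \<delta>\<^sub>0
    by (intro neumann_eigenvalue_gt_mu_tilde) (auto simp: is_first_neumann_eigenvalue_def)
  \<comment> \<open>The first bound permits comparing the brackets of \<open>F\<close> and
    \<open>F_tilde\<close>; the second leads to the quartic and thus to the last two claims.\<close>
  have mut: "real n \<le> mu_tilde n \<delta>\<^sub>0" "real n / (1 - x\<^sup>2) \<le> mu_tilde n \<delta>\<^sub>0"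
    using mu_tilde_bounds[OF \<delta>\<^sub>0(1,2), of k] by (simp_all add: k x_def add.commute)
  show "\<exists>\<delta>'. {\<delta> \<in> {0<..<pi / 2}. F_tilde n \<delta> = 0} = {\<delta>'} \<and> \<delta>\<^sub>0 > \<delta>'"
  proof -
    obtain \<delta>' where \<delta>': "0 < \<delta>'" "\<delta>' < pi / 2" "F_tilde n \<delta>' = 0"
      using F_tilde_zero_exists[OF \<open>n \<ge> 2\<close>] .
    have uniq: "\<delta> = \<delta>'" if "0 < \<delta>" "\<delta> < pi / 2" "F_tilde n \<delta> = 0" for \<delta>
      using F_tilde_strict_antimono[OF \<open>n \<ge> 2\<close>, of \<delta> \<delta>'] F_tilde_strict_antimono[OF \<open>n \<ge> 2\<close>, of \<delta>' \<delta>] that \<delta>'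
      by (cases \<delta> \<delta>' rule: linorder_cases) auto
    have "{\<delta> \<in> {0<..<pi / 2}. F_tilde n \<delta> = 0} = {\<delta>'}"
    proof (intro equalityI subsetI)
      fix \<delta> assume "\<delta> \<in> {\<delta> \<in> {0<..<pi / 2}. F_tilde n \<delta> = 0}"
      then have "0 < \<delta>" "\<delta> < pi / 2" "F_tilde n \<delta> = 0" by auto
      then have "\<delta> = \<delta>'" by (rule uniq)
      then show "\<delta> \<in> {\<delta>'}" by simp
    qed (use \<delta>' in simp)
    moreover have "F_tilde n \<delta>\<^sub>0 < 0"
    proof -
      have "denom (real n) (\<mu> \<delta>\<^sub>0) x < denom (real n) (mu_tilde n \<delta>\<^sub>0) x"
        using n mut mu x by (intro denom_strict_antimono)
      moreover have "0 < denom (real n) (\<mu> \<delta>\<^sub>0) x" using n mut mu x by (intro denom_pos) auto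
      ultimately have "inverse (denom (real n) (mu_tilde n \<delta>\<^sub>0) x) < inverse (denom (real n) (\<mu> \<delta>\<^sub>0) x)"
        by (intro less_imp_inverse_less)
      then have "(real n + 1) / (8 * real n) * inverse (denom (real n) (mu_tilde n \<delta>\<^sub>0) x)
          < (real n + 1) / (8 * real n) * inverse (denom (real n) (\<mu> \<delta>\<^sub>0) x)"
        using n by (intro mult_strict_left_mono) auto
      then have "F_tilde n \<delta>\<^sub>0 < F n \<mu> \<delta>\<^sub>0" unfolding F_tilde_eq F_eq x_def by simp
      then show ?thesis using \<delta>\<^sub>0 by simp
    qed
    then have "\<delta>' < \<delta>\<^sub>0"
      using F_tilde_strict_antimono[OF \<open>n \<ge> 2\<close>, of \<delta>\<^sub>0 \<delta>'] \<delta>' \<delta>\<^sub>0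
      by (cases \<delta>\<^sub>0 \<delta>' rule: linorder_cases) auto
    ultimately show ?thesis by blast
  qed
  have neg: "quartic (real n) x < 0"
  proof (rule quartic_neg[OF n(1) x])
    show "real n / (1 - x\<^sup>2) < \<mu> \<delta>\<^sub>0" using mut mu by simp
    show "(real n + 1) / (8 * real n) * inverse (denom (real n) (\<mu> \<delta>\<^sub>0) x)
       + ((real n + 3) * x\<^sup>2 - 4) / (4 * (1 - x\<^sup>2)) = 0"
      using \<delta>\<^sub>0(3) unfolding F_eq x_def .
  qed
  obtain \<kappa> where \<kappa>: "{x \<in> {0<..<1}. quartic (real n) x = 0} = {\<kappa>}"
    "\<And>x. 0 < x \<Longrightarrow> x < 1 \<Longrightarrow> quartic (real n) x < 0 \<Longrightarrow> x < \<kappa>"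
    by (rule quartic_zero[OF n(1)]) (rule that; assumption)
  have "cos \<delta>\<^sub>0 < \<kappa>" using \<kappa>(2)[OF x neg] by (simp add: x_def)
  with \<kappa>(1) show "\<exists>\<kappa>. {x \<in> {0<..<1}. real n * (real n + 3) * x ^ 4 + real n * (real n + 3) * x ^ 3
              + 2 * real n * (real n + 1) * x\<^sup>2 + (1 - 3 * real n) * x - 7 * real n + 1 = 0} = {\<kappa>}
          \<and> cos \<delta>\<^sub>0 < \<kappa>"
    unfolding quartic_def by blast
  show "(cos \<delta>\<^sub>0)\<^sup>2 < (7 * real n - 1) / (2 * (real n)\<^sup>2 + 5 * real n - 1)"
    using quartic_neg_imp_square_less[OF n(1) x neg] by (simp add: x_def)
qed

end
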